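(* The following statement fails for the hyperbolic group $G=(F_4\times\mathbb{Z}/2\mathbb{Z})\star F_4$, where $F_4$ is the free group of rank $4$ and $\star$ denotes the free product: "For every choice of generators $a_1,\dots,a_m$ of $G$, with $\theta$ the gross cogrowth of $G$ with respect to $a_1,\dots,a_m$, and for every density $d\in[0,1]$, if for each length $\ell$ a set $R$ of $(2m)^{d\ell}$ words is picked uniformly at random among all words of length $\ell$ in $a_1^{\pm1},\dots,a_m^{\pm1}$, then: if $d<1-\theta$, with probability tending to $1$ as $\ell\to\infty$ the quotient $G/\langle R\rangle$ is non-elementary hyperbolic; and if $d>1-\theta$, with probability tending to $1$ as $\ell\to\infty$ the quotient $G/\langle R\rangle$ is either $\{e\}$ or $\mathbb{Z}/2\mathbb{Z}$." That is, for this group there exist generators $a_1,\dots,a_m$ and a density $d\in[0,1]$ for which this conclusion is false.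
   Context: $\langle R\rangle$ is the normal subgroup generated by $R$. A hyperbolic group is non-elementary if it is neither finite nor quasi-isometric to $\mathbb{Z}$. Words are arbitrary (not necessarily reduced) sequences of letters among the $2m$ letters $a_1^{\pm1},\dots,a_m^{\pm1}$. The gross cogrowth of $G$ with respect to $a_1,\dots,a_m$ is $$\theta=\lim_{\ell\to\infty,\ \ell\text{ even}}\frac1\ell\log_{2m}\#\{w\text{ word of length }\ell:\ w=e\text{ in }G\}.$$ Words are drawn independently and uniformly; $(2m)^{d\ell}$ is replaced by its integer part. *)

theory Defs
  imports "HOL-Algebra.Elementary_Groups" "HOL-Probability.Probability"
begin

section \<open>Free groups and free products\<close>

text \<open>
  The monoid with generators \<open>L\<close> and defining relations \<open>x = y\<close> for \<open>(x, y) \<in> r\<close>: words over \<open>L\<close>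
  modulo the congruence on the free monoid generated by \<open>r\<close>. Elements are congruence classes.
\<close>

definition monoid_congruence ::
  "'a set \<Rightarrow> ('a list \<times> 'a list) set \<Rightarrow> ('a list \<times> 'a list) set" where
  "monoid_congruence L r =
     (let s = {(u @ x @ v, u @ y @ v) | u v x y. u \<in> lists L \<and> v \<in> lists L \<and> (x, y) \<in> r}
      in (s \<union> s\<inverse>)\<^sup>*)"

definition presented_monoid :: "'a set \<Rightarrow> ('a list \<times> 'a list) set \<Rightarrow> 'a list set monoid" where
  "presented_monoid L r =
     \<lparr>carrier = lists L // monoid_congruence L r,
      monoid.mult = (\<lambda>A B. \<Union>u\<in>A. \<Union>v\<in>B. monoid_congruence L r `` {u @ v}),
      one = monoid_congruence L r `` {[]}\<rparr>"

text \<open>The letter \<open>(x, True)\<close> stands for the generator \<open>x\<close> and \<open>(x, False)\<close> for its inverse.\<close>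

definition free_group :: "'a set \<Rightarrow> ('a \<times> bool) list set monoid" where
  "free_group B =
     presented_monoid (B \<times> UNIV) {([(x, s), (x, \<not> s)], []) | x s. x \<in> B}"

definition free_product ::
  "('a, 'c) monoid_scheme \<Rightarrow> ('b, 'd) monoid_scheme \<Rightarrow> ('a + 'b) list set monoid" where
  "free_product G H =
     presented_monoid (Inl ` carrier G \<union> Inr ` carrier H)
       ({([Inl x, Inl y], [Inl (x \<otimes>\<^bsub>G\<^esub> y)]) | x y. x \<in> carrier G \<and> y \<in> carrier G} \<union>
        {([Inr x, Inr y], [Inr (x \<otimes>\<^bsub>H\<^esub> y)]) | x y. x \<in> carrier H \<and> y \<in> carrier H} \<union>
        {([Inl \<one>\<^bsub>G\<^esub>], []), ([Inr \<one>\<^bsub>H\<^esub>], [])})"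

section \<open>Hyperbolic groups\<close>

definition generating_set :: "('a, 'b) monoid_scheme \<Rightarrow> 'a set \<Rightarrow> bool" where
  "generating_set G S \<longleftrightarrow> S \<subseteq> carrier G \<and> generate G S = carrier G"

definition word_length :: "('a, 'b) monoid_scheme \<Rightarrow> 'a set \<Rightarrow> 'a \<Rightarrow> nat" where
  "word_length G S g =
     (LEAST n. \<exists>xs. length xs = n \<and> set xs \<subseteq> S \<union> m_inv G ` S \<and> foldr (monoid.mult G) xs \<one>\<^bsub>G\<^esub> = g)"

definition word_dist :: "('a, 'b) monoid_scheme \<Rightarrow> 'a set \<Rightarrow> 'a \<Rightarrow> 'a \<Rightarrow> real" where
  "word_dist G S x y = real (word_length G S (inv\<^bsub>G\<^esub> x \<otimes>\<^bsub>G\<^esub> y))"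

definition gromov_product :: "('a \<Rightarrow> 'a \<Rightarrow> real) \<Rightarrow> 'a \<Rightarrow> 'a \<Rightarrow> 'a \<Rightarrow> real" where
  "gromov_product dst w x y = (dst x w + dst y w - dst x y) / 2"

definition gromov_hyperbolic :: "'a set \<Rightarrow> ('a \<Rightarrow> 'a \<Rightarrow> real) \<Rightarrow> real \<Rightarrow> bool" where
  "gromov_hyperbolic M dst \<delta> \<longleftrightarrow>
     (\<forall>w\<in>M. \<forall>x\<in>M. \<forall>y\<in>M. \<forall>z\<in>M.
        gromov_product dst w x z
          \<ge> min (gromov_product dst w x y) (gromov_product dst w y z) - \<delta>)"

text \<open>
  Hyperbolicity and quasi-isometry type do not depend on the finite generating sets, so it suffices
  to ask for some.
\<close>

definition hyperbolic_group :: "('a, 'b) monoid_scheme \<Rightarrow> bool" where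
  "hyperbolic_group G \<longleftrightarrow>
     group G \<and>
     (\<exists>S. finite S \<and> generating_set G S \<and>
        (\<exists>\<delta>. gromov_hyperbolic (carrier G) (word_dist G S) \<delta>))"

definition quasi_isometric ::
  "'a set \<Rightarrow> ('a \<Rightarrow> 'a \<Rightarrow> real) \<Rightarrow> 'b set \<Rightarrow> ('b \<Rightarrow> 'b \<Rightarrow> real) \<Rightarrow> bool" where
  "quasi_isometric M dM N dN \<longleftrightarrow>
     (\<exists>f K C. K \<ge> 1 \<and> C \<ge> 0 \<and> f \<in> M \<rightarrow> N \<and>
        (\<forall>x\<in>M. \<forall>y\<in>M. dM x y / K - C \<le> dN (f x) (f y) \<and> dN (f x) (f y) \<le> K * dM x y + C) \<and>
        (\<forall>z\<in>N. \<exists>x\<in>M. dN z (f x) \<le> C))"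

definition quasi_isometric_groups ::
  "('a, 'c) monoid_scheme \<Rightarrow> ('b, 'd) monoid_scheme \<Rightarrow> bool" where
  "quasi_isometric_groups G H \<longleftrightarrow>
     (\<exists>S T. finite S \<and> generating_set G S \<and> finite T \<and> generating_set H T \<and>
        quasi_isometric (carrier G) (word_dist G S) (carrier H) (word_dist H T))"

definition non_elementary_hyperbolic :: "('a, 'b) monoid_scheme \<Rightarrow> bool" where
  "non_elementary_hyperbolic G \<longleftrightarrow>
     hyperbolic_group G \<and> infinite (carrier G) \<and> \<not> quasi_isometric_groups G integer_group"

section \<open>Words, cogrowth and random quotients\<close>

text \<open>
  Letters are formal: \<open>(i, True)\<close> is the \<open>i\<close>-th generator and \<open>(i, False)\<close> its inverse, so there are
  \<open>2 * m\<close> of them even if some generators coincide or are involutions.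
\<close>

definition words :: "nat \<Rightarrow> nat \<Rightarrow> (nat \<times> bool) list set" where
  "words m l = {w. set w \<subseteq> {..<m} \<times> UNIV \<and> length w = l}"

definition eval_word :: "('a, 'b) monoid_scheme \<Rightarrow> 'a list \<Rightarrow> (nat \<times> bool) list \<Rightarrow> 'a" where
  "eval_word G gens w =
     foldr (monoid.mult G) (map (\<lambda>(i, s). if s then gens ! i else inv\<^bsub>G\<^esub> (gens ! i)) w) \<one>\<^bsub>G\<^esub>"

definition has_gross_cogrowth :: "('a, 'b) monoid_scheme \<Rightarrow> 'a list \<Rightarrow> real \<Rightarrow> bool" where
  "has_gross_cogrowth G gens \<theta> \<longleftrightarrow>
     (\<lambda>k. log (2 * real (length gens))
            (real (card {w \<in> words (length gens) (2 * k). eval_word G gens w = \<one>\<^bsub>G\<^esub>}))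
          / real (2 * k)) \<longlonglongrightarrow> \<theta>"

definition normal_closure :: "('a, 'b) monoid_scheme \<Rightarrow> 'a set \<Rightarrow> 'a set" where
  "normal_closure G R = \<Inter>{N. N \<lhd> G \<and> R \<subseteq> N}"

definition random_words :: "nat \<Rightarrow> real \<Rightarrow> nat \<Rightarrow> (nat \<times> bool) list list pmf" where
  "random_words m d l =
     replicate_pmf (nat \<lfloor>(2 * real m) powr (d * real l)\<rfloor>) (pmf_of_set (words m l))"

definition quotient_by_words ::
  "('a, 'b) monoid_scheme \<Rightarrow> 'a list \<Rightarrow> (nat \<times> bool) list list \<Rightarrow> 'a set monoid" where
  "quotient_by_words G gens R = G Mod normal_closure G (eval_word G gens ` set R)"

definition random_quotient_asymptotically_surely ::
  "('a, 'b) monoid_scheme \<Rightarrow> 'a list \<Rightarrow> real \<Rightarrow> ('a set monoid \<Rightarrow> bool) \<Rightarrow> bool" where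
  "random_quotient_asymptotically_surely G gens d P \<longleftrightarrow>
     (\<lambda>l. measure_pmf.prob (random_words (length gens) d l)
            {R. P (quotient_by_words G gens R)}) \<longlonglongrightarrow> 1"

definition random_quotient_phase_transition :: "('a, 'b) monoid_scheme \<Rightarrow> bool" where
  "random_quotient_phase_transition G \<longleftrightarrow>
     (\<forall>gens \<theta> d. generating_set G (set gens) \<longrightarrow> has_gross_cogrowth G gens \<theta> \<longrightarrow> d \<in> {0..1} \<longrightarrow>
        (d < 1 - \<theta> \<longrightarrow> random_quotient_asymptotically_surely G gens d non_elementary_hyperbolic) \<and>
        (d > 1 - \<theta> \<longrightarrow>
           random_quotient_asymptotically_surely G gens d
             (\<lambda>Q. trivial_group Q \<or> Q \<cong> integer_mod_group 2)))"

end

theory Submission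
  imports Defs "HOL-Library.Sublist"
begin

text \<open>
  Let \<open>e\<close> generate the factor \<open>\<int>/2\<int>\<close>, let \<open>a\<^sub>i\<close> be free generators of the \<open>F\<^sub>4\<close> that commutes with \<open>e\<close>
  and \<open>b\<^sub>i\<close> free generators of the other \<open>F\<^sub>4\<close>. The element \<open>e\<close> is torsion, its centralizer is large,
  and yet it is not central; this is what breaks the phase transition. Put \<open>d\<^sub>i = e b\<^sub>i e b\<^sub>i\<^sup>-\<^sup>1\<close>. Suppose
  that a normal subgroup \<open>N\<close> contains, for every \<open>i\<close>, an element \<open>h b\<^sub>i\<close> with \<open>h\<close> a product of
  \<open>a\<^sub>j\<^sup>\<plusminus>\<^sup>1\<close>, and an element \<open>g a\<^sub>i\<close> with \<open>g\<close> a product of \<open>d\<^sub>j\<^sup>\<plusminus>\<^sup>1\<close>. Modulo \<open>N\<close> the element \<open>b\<^sub>i = h\<^sup>-\<^sup>1\<close>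
  commutes with \<open>e\<close>, so all \<open>d\<^sub>i\<close> are trivial; hence so are all \<open>a\<^sub>i\<close>, and then all \<open>b\<^sub>i\<close>. What is left of
  the group is at most \<open>{1, e}\<close> (\<open>finite_quotient\<close>).

  Random relators of this shape appear before relators that are trivial in the group do. Take as
  generating list \<open>k\<close> copies of the \<open>a\<^sub>i\<close> and of the \<open>d\<^sub>i\<close> together with \<open>b\<^sub>i\<close> and \<open>e\<close>, where \<open>i\<close> runs over \<open>n\<close>
  indices. There are at least \<open>(2kn)\<^sup>l\<^sup>-\<^sup>1\<close> words of length \<open>l\<close> of either shape. The \<open>a\<^sub>i\<close> and \<open>d\<^sub>i\<close> are a free
  basis of a free group of rank \<open>2n\<close>, in which far fewer words are trivial: the number of trivial words
  of length \<open>l\<close> is at most \<open>\<Lambda>\<^sup>l\<close> with \<open>\<Lambda> = k (n + 15/4) + 4n + 2\<close>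
  (\<open>card_trivial_walk_words_le\<close>). For \<open>n \<ge> 4\<close> and large \<open>k\<close> this is smaller than \<open>2kn\<close>. A density
  corresponding to a growth rate strictly between \<open>\<Lambda>\<close> and \<open>2kn\<close> lies below \<open>1 - \<theta>\<close>, but at this density
  all the required relators occur with probability tending to \<open>1\<close>, so the quotient is finite instead
  of non-elementary (\<open>no_phase_transition\<close>).

  Both the bound \<open>\<Lambda>\<close> and hyperbolicity come from a normal form. With \<open>c\<^sub>i = e b\<^sub>i e\<close> the group is the
  semidirect product of the free group on the \<open>a\<^sub>i, b\<^sub>i, c\<^sub>i\<close> with \<open>{1, e}\<close>, where \<open>e\<close> fixes \<open>a\<^sub>i\<close> and
  exchanges \<open>b\<^sub>i\<close> and \<open>c\<^sub>i\<close>. Every element is therefore \<open>w e\<^sup>s\<close> for a unique reduced word \<open>w\<close> and a unique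
  \<open>s \<in> {0, 1}\<close>. The length of \<open>w\<close> defines a tree metric, and word length with respect to the generators
  \<open>a\<^sub>i, b\<^sub>i, c\<^sub>i, e\<close> is within \<open>1\<close> of it. A function that decays exponentially with a
  weighted length of \<open>w\<close> is superharmonic up to the factor \<open>\<Lambda>\<close>.
\<close>

section \<open>Presented monoids\<close>

locale monoid_presentation =
  fixes L :: "'a set" and r :: "('a list \<times> 'a list) set"
  assumes relators_in_lists: "r \<subseteq> lists L \<times> lists L"
begin

abbreviation "M \<equiv> presented_monoid L r"

definition cls :: "'a list \<Rightarrow> 'a list set" where
  "cls u = monoid_congruence L r `` {u}"

text \<open>
  The congruence is only ever used through quantities \<open>f\<close> that a single replacement preserves: being a
  word over \<open>L\<close>, the class of a product, and the effect of an action are all of this kind.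
\<close>

lemma congruence_invariant:
  assumes "(u, v) \<in> monoid_congruence L r"
    and step: "\<And>p q x y. p \<in> lists L \<Longrightarrow> q \<in> lists L \<Longrightarrow> (x, y) \<in> r \<Longrightarrow> f (p @ x @ q) = f (p @ y @ q)"
  shows "f u = f v"
proof -
  have "(u, v) \<in> ({(p @ x @ q, p @ y @ q) | p q x y. p \<in> lists L \<and> q \<in> lists L \<and> (x, y) \<in> r}
      \<union> {(p @ x @ q, p @ y @ q) | p q x y. p \<in> lists L \<and> q \<in> lists L \<and> (x, y) \<in> r}\<inverse>)\<^sup>*"
    using assms(1) unfolding monoid_congruence_def Let_def .
  then show ?thesis
  proof induction
    case (step y z)
    obtain p q x y' where *: "p \<in> lists L" "q \<in> lists L" "(x, y') \<in> r"
      "y = p @ x @ q \<and> z = p @ y' @ q \<or> z = p @ x @ q \<and> y = p @ y' @ q"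
      using step(2) by blast
    have "f y = f z"
      using assms(2)[OF *(1-3)] *(4) by auto
    then show ?case using step.IH by simp
  qed simp
qed

lemma congruence_equiv: "equiv UNIV (monoid_congruence L r)"
  unfolding monoid_congruence_def Let_def
  by (intro equivI) (auto simp: refl_rtrancl sym_Un_converse sym_rtrancl trans_rtrancl)

lemma cls_eq_iff: "cls u = cls v \<longleftrightarrow> (u, v) \<in> monoid_congruence L r"
  unfolding cls_def by (rule eq_equiv_class_iff[OF congruence_equiv]) auto

lemma mem_cls_iff: "v \<in> cls u \<longleftrightarrow> cls u = cls v"
  unfolding cls_eq_iff by (simp add: cls_def)

lemma self_in_cls: "u \<in> cls u"
  by (simp add: mem_cls_iff)

lemma cls_step:
  assumes "p \<in> lists L" "q \<in> lists L" "(x, y) \<in> r"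
  shows "cls (p @ x @ q) = cls (p @ y @ q)"
  unfolding cls_eq_iff monoid_congruence_def Let_def using assms by blast

lemma cls_relator: "(x, y) \<in> r \<Longrightarrow> cls x = cls y"
  using cls_step[of "[]" "[]"] by simp

lemma cls_lists: "cls u = cls v \<Longrightarrow> u \<in> lists L \<longleftrightarrow> v \<in> lists L"
  unfolding cls_eq_iff
  by (erule congruence_invariant) (use relators_in_lists in auto)

lemma cls_append:
  assumes "cls u = cls u'" "cls v = cls v'" "u \<in> lists L" "v \<in> lists L"
  shows "cls (u @ v) = cls (u' @ v')"
proof -
  have "cls (u @ v) = cls (u' @ v)"
    by (rule congruence_invariant[of u u' "\<lambda>w. cls (w @ v)"])
      (use assms cls_eq_iff cls_step[of _ "_ @ v"] in auto)
  also have "\<dots> = cls (u' @ v')"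
    by (rule congruence_invariant[of v v' "\<lambda>w. cls (u' @ w)"])
      (use assms cls_eq_iff cls_lists cls_step[of "u' @ _"] in auto)
  finally show ?thesis .
qed

lemma carrier_eq: "carrier M = cls ` lists L"
  by (auto simp: presented_monoid_def quotient_def cls_def)

lemma cls_in_carrier: "u \<in> lists L \<Longrightarrow> cls u \<in> carrier M"
  by (simp add: carrier_eq)

lemma carrierE:
  assumes "g \<in> carrier M"
  obtains u where "u \<in> lists L" "g = cls u"
  using assms unfolding carrier_eq by blast

lemma one_eq: "\<one>\<^bsub>M\<^esub> = cls []"
  by (simp add: presented_monoid_def cls_def)

lemma mult_cls:
  assumes "u \<in> lists L" "v \<in> lists L"
  shows "cls u \<otimes>\<^bsub>M\<^esub> cls v = cls (u @ v)"
proof -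
  have "cls u \<otimes>\<^bsub>M\<^esub> cls v = (\<Union>u'\<in>cls u. \<Union>v'\<in>cls v. cls (u' @ v'))"
    by (simp add: presented_monoid_def cls_def)
  also have "\<dots> = (\<Union>u'\<in>cls u. \<Union>v'\<in>cls v. cls (u @ v))"
    using cls_append[OF _ _ assms] by (intro SUP_cong refl) (simp add: mem_cls_iff)
  also have "\<dots> = cls (u @ v)"
    using self_in_cls by blast
  finally show ?thesis .
qed

text \<open>
  Left inverses of the letters, multiplied in the opposite order, give a left inverse of a word.
\<close>

lemma group_presented_monoid:
  assumes "\<And>x. x \<in> L \<Longrightarrow> \<exists>y\<in>L. cls [y, x] = cls []"
  shows "group M"
proof (rule groupI)
  fix g assume "g \<in> carrier M"
  then obtain u where u: "u \<in> lists L" "g = cls u" by (auto simp: carrier_eq)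
  have "\<exists>v\<in>lists L. cls (v @ u) = cls []"
    using u(1)
  proof (induction u)
    case (Cons x u)
    then obtain v where v: "v \<in> lists L" "cls (v @ u) = cls []" by auto
    obtain y where y: "y \<in> L" "cls [y, x] = cls []" using assms[of x] Cons by auto
    have "cls (v @ [y, x] @ u) = cls (v @ [] @ u)"
      by (intro cls_append refl y(2)) (use v y Cons in auto)
    then show ?case using v y by (intro bexI[of _ "v @ [y]"]) auto
  qed (auto intro: bexI[of _ "[]"])
  then show "\<exists>h\<in>carrier M. h \<otimes>\<^bsub>M\<^esub> g = \<one>\<^bsub>M\<^esub>"
    using u by (auto simp: carrier_eq one_eq mult_cls)
qed (simp add: one_eq mult_cls cls_in_carrier | elim carrierE)+

text \<open>
  Words act from the right, the first letter first, so that \<open>fold\<close> turns concatenation into composition.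
  The representative is irrelevant as soon as both sides of each relator act in the same way.
\<close>

definition class_action :: "('a \<Rightarrow> 'p \<Rightarrow> 'p) \<Rightarrow> 'a list set \<Rightarrow> 'p \<Rightarrow> 'p" where
  "class_action \<phi> A = fold \<phi> (SOME u. u \<in> A)"

lemma fold_preserves:
  assumes "\<And>x p. x \<in> L \<Longrightarrow> p \<in> P \<Longrightarrow> \<phi> x p \<in> P" "u \<in> lists L" "p \<in> P"
  shows "fold \<phi> u p \<in> P"
  using assms(2,3) by (induction u arbitrary: p) (auto simp: assms(1))

lemma class_action_cls:
  assumes closed: "\<And>x p. x \<in> L \<Longrightarrow> p \<in> P \<Longrightarrow> \<phi> x p \<in> P"
    and rel: "\<And>x y p. (x, y) \<in> r \<Longrightarrow> p \<in> P \<Longrightarrow> fold \<phi> x p = fold \<phi> y p"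
    and "p \<in> P"
  shows "class_action \<phi> (cls u) p = fold \<phi> u p"
proof -
  have "(SOME v. v \<in> cls u) \<in> cls u"
    by (rule someI[of _ u]) (simp add: mem_cls_iff)
  then have "(u, SOME v. v \<in> cls u) \<in> monoid_congruence L r"
    by (simp add: mem_cls_iff cls_eq_iff)
  then have "fold \<phi> u p = fold \<phi> (SOME v. v \<in> cls u) p"
  proof (rule congruence_invariant[of _ _ "\<lambda>u. fold \<phi> u p"])
    fix a b x y assume *: "a \<in> lists L" "b \<in> lists L" "(x, y) \<in> r"
    have "fold \<phi> a p \<in> P" by (rule fold_preserves) (use * assms in auto)
    then show "fold \<phi> (a @ x @ b) p = fold \<phi> (a @ y @ b) p"
      using rel[OF *(3)] by simp
  qed
  then show ?thesis by (simp add: class_action_def)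
qed

text \<open>
  The universal property of the presentation, for actions. It is stated relative to an invariant set
  \<open>P\<close> because cancellation of inverse letters is an identity on reduced words only.
\<close>

lemma class_action:
  assumes closed: "\<And>x p. x \<in> L \<Longrightarrow> p \<in> P \<Longrightarrow> \<phi> x p \<in> P"
    and rel: "\<And>x y p. (x, y) \<in> r \<Longrightarrow> p \<in> P \<Longrightarrow> fold \<phi> x p = fold \<phi> y p"
    and p: "p \<in> P"
  shows "x \<in> L \<Longrightarrow> class_action \<phi> (cls [x]) p = \<phi> x p"
    and "class_action \<phi> \<one>\<^bsub>M\<^esub> p = p"
    and "g \<in> carrier M \<Longrightarrow> class_action \<phi> g p \<in> P"
    and "g \<in> carrier M \<Longrightarrow> h \<in> carrier M \<Longrightarrow>
      class_action \<phi> (g \<otimes>\<^bsub>M\<^esub> h) p = class_action \<phi> h (class_action \<phi> g p)"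
proof -
  have cls: "class_action \<phi> (cls u) q = fold \<phi> u q" if "q \<in> P" for u q
    by (rule class_action_cls) (use closed rel that in auto)
  have closed': "fold \<phi> u p \<in> P" if "u \<in> lists L" for u
    by (rule fold_preserves) (use closed p that in auto)
  show "x \<in> L \<Longrightarrow> class_action \<phi> (cls [x]) p = \<phi> x p" "class_action \<phi> \<one>\<^bsub>M\<^esub> p = p"
    by (simp_all add: cls p one_eq)
  show "class_action \<phi> g p \<in> P" if "g \<in> carrier M"
    using that by (rule carrierE) (simp add: cls p closed')
  show "class_action \<phi> (g \<otimes>\<^bsub>M\<^esub> h) p = class_action \<phi> h (class_action \<phi> g p)"
    if "g \<in> carrier M" "h \<in> carrier M"
    using that by (elim carrierE) (simp add: mult_cls cls p closed')
qed

lemma cls_Cons: "x \<in> L \<Longrightarrow> u \<in> lists L \<Longrightarrow> cls (x # u) = cls [x] \<otimes>\<^bsub>M\<^esub> cls u"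
  by (simp add: mult_cls)

end

section \<open>Free groups and free products as presented monoids\<close>

definition inverse_relators :: "'a set \<Rightarrow> (('a \<times> bool) list \<times> ('a \<times> bool) list) set" where
  "inverse_relators X = {([(x, s), (x, \<not> s)], []) | x s. x \<in> X}"

interpretation free: monoid_presentation "X \<times> UNIV" "inverse_relators X" for X :: "'a set"
  by unfold_locales (auto simp: inverse_relators_def)

lemma free_group_eq: "free_group X = presented_monoid (X \<times> UNIV) (inverse_relators X)"
  by (simp add: free_group_def inverse_relators_def)

lemma group_free_group: "group (free_group X)"
  unfolding free_group_eq
proof (rule free.group_presented_monoid)
  fix x :: "'a \<times> bool" assume "x \<in> X \<times> UNIV"
  then show "\<exists>y\<in>X \<times> UNIV. free.cls X [y, x] = free.cls X []"
    by (intro bexI[of _ "(fst x, \<not> snd x)"] free.cls_relator) (auto simp: inverse_relators_def)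
qed

locale free_product_of_groups = G: group G + H: group H
  for G :: "('a, 'c) monoid_scheme" and H :: "('b, 'd) monoid_scheme"
begin

definition factor_letters :: "('a + 'b) set" where
  "factor_letters = Inl ` carrier G \<union> Inr ` carrier H"

definition factor_relators :: "(('a + 'b) list \<times> ('a + 'b) list) set" where
  "factor_relators =
     {([Inl x, Inl y], [Inl (x \<otimes>\<^bsub>G\<^esub> y)]) | x y. x \<in> carrier G \<and> y \<in> carrier G} \<union>
     {([Inr x, Inr y], [Inr (x \<otimes>\<^bsub>H\<^esub> y)]) | x y. x \<in> carrier H \<and> y \<in> carrier H} \<union>
     {([Inl \<one>\<^bsub>G\<^esub>], []), ([Inr \<one>\<^bsub>H\<^esub>], [])}"

lemma mem_factor_letters [simp]:
  "Inl x \<in> factor_letters \<longleftrightarrow> x \<in> carrier G" "Inr y \<in> factor_letters \<longleftrightarrow> y \<in> carrier H"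
  by (auto simp: factor_letters_def)

lemma factor_relatorsI:
  "x \<in> carrier G \<Longrightarrow> x' \<in> carrier G \<Longrightarrow> ([Inl x, Inl x'], [Inl (x \<otimes>\<^bsub>G\<^esub> x')]) \<in> factor_relators"
  "y \<in> carrier H \<Longrightarrow> y' \<in> carrier H \<Longrightarrow> ([Inr y, Inr y'], [Inr (y \<otimes>\<^bsub>H\<^esub> y')]) \<in> factor_relators"
  "([Inl \<one>\<^bsub>G\<^esub>], []) \<in> factor_relators" "([Inr \<one>\<^bsub>H\<^esub>], []) \<in> factor_relators"
  by (auto simp: factor_relators_def)

sublocale monoid_presentation factor_letters factor_relators
  by unfold_locales (auto simp: factor_relators_def)

lemma free_product_eq: "free_product G H = M"
  by (simp only: free_product_def factor_letters_def factor_relators_def)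

definition inl :: "'a \<Rightarrow> ('a + 'b) list set" where
  "inl x = cls [Inl x]"

definition inr :: "'b \<Rightarrow> ('a + 'b) list set" where
  "inr y = cls [Inr y]"

lemma inl_closed [simp]: "x \<in> carrier G \<Longrightarrow> inl x \<in> carrier M"
  and inr_closed [simp]: "y \<in> carrier H \<Longrightarrow> inr y \<in> carrier M"
  by (simp_all add: inl_def inr_def cls_in_carrier)

lemma inl_mult: "x \<in> carrier G \<Longrightarrow> x' \<in> carrier G \<Longrightarrow> inl (x \<otimes>\<^bsub>G\<^esub> x') = inl x \<otimes>\<^bsub>M\<^esub> inl x'"
  unfolding inl_def by (subst mult_cls) (simp_all add: cls_relator[OF factor_relatorsI(1)] cls_relator[OF factor_relatorsI(2)])

lemma inr_mult: "y \<in> carrier H \<Longrightarrow> y' \<in> carrier H \<Longrightarrow> inr (y \<otimes>\<^bsub>H\<^esub> y') = inr y \<otimes>\<^bsub>M\<^esub> inr y'"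
  unfolding inr_def by (subst mult_cls) (simp_all add: cls_relator[OF factor_relatorsI(1)] cls_relator[OF factor_relatorsI(2)])

lemma inl_one: "inl \<one>\<^bsub>G\<^esub> = \<one>\<^bsub>M\<^esub>" and inr_one: "inr \<one>\<^bsub>H\<^esub> = \<one>\<^bsub>M\<^esub>"
  unfolding inl_def inr_def one_eq by (intro cls_relator factor_relatorsI)+

lemma group_free_product: "group M"
proof (rule group_presented_monoid)
  fix z assume "z \<in> factor_letters"
  then consider x where "z = Inl x" "x \<in> carrier G" | y where "z = Inr y" "y \<in> carrier H"
    unfolding factor_letters_def by blast
  then show "\<exists>z'\<in>factor_letters. cls [z', z] = cls []"
  proof cases
    case (1 x)
    have "cls [Inl (inv\<^bsub>G\<^esub> x), Inl x] = inl (inv\<^bsub>G\<^esub> x) \<otimes>\<^bsub>M\<^esub> inl x"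
      unfolding inl_def using 1 by (subst mult_cls) auto
    also have "\<dots> = cls []"
      using 1 inl_one by (simp add: inl_mult[symmetric] one_eq)
    finally show ?thesis using 1 by (intro bexI[of _ "Inl (inv\<^bsub>G\<^esub> x)"]) auto
  next
    case (2 y)
    have "cls [Inr (inv\<^bsub>H\<^esub> y), Inr y] = inr (inv\<^bsub>H\<^esub> y) \<otimes>\<^bsub>M\<^esub> inr y"
      unfolding inr_def using 2 by (subst mult_cls) auto
    also have "\<dots> = cls []"
      using 2 inr_one by (simp add: inr_mult[symmetric] one_eq)
    finally show ?thesis using 2 by (intro bexI[of _ "Inr (inv\<^bsub>H\<^esub> y)"]) auto
  qed
qed

lemma factors_generate:
  assumes "subgroup K M" "inl ` carrier G \<subseteq> K" "inr ` carrier H \<subseteq> K"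
  shows "K = carrier M"
proof
  show "K \<subseteq> carrier M" using assms(1) by (rule subgroup.subset)
  show "carrier M \<subseteq> K"
  proof
    fix g assume "g \<in> carrier M"
    then obtain u where u: "u \<in> lists factor_letters" "g = cls u"
      by (rule carrierE)
    have "cls u \<in> K"
      using u(1)
    proof (induction u)
      case Nil
      then show ?case using subgroup.one_closed[OF assms(1)] by (simp add: one_eq)
    next
      case (Cons z u)
      then have "cls [z] \<in> K" using assms(2,3) by (cases z) (auto simp: inl_def inr_def)
      then show ?case
        using Cons subgroup.m_closed[OF assms(1)] by (subst cls_Cons) auto
    qed
    then show "g \<in> K" using u(2) by simp
  qed
qed

end

section \<open>Reduced words\<close>

definition inv_letter :: "'a \<times> bool \<Rightarrow> 'a \<times> bool" where
  "inv_letter x = (fst x, \<not> snd x)"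

lemma inv_letter_simps [simp]:
  "inv_letter (i, s) = (i, \<not> s)" "inv_letter (inv_letter x) = x"
  "inv_letter x \<noteq> x" "x \<noteq> inv_letter x" "fst (inv_letter x) = fst x"
  "inv_letter x = inv_letter y \<longleftrightarrow> x = y"
  by (auto simp: inv_letter_def prod_eq_iff)

lemma eq_inv_letter_iff: "x = inv_letter y \<longleftrightarrow> y = inv_letter x"
  by auto

definition inv_word :: "('a \<times> bool) list \<Rightarrow> ('a \<times> bool) list" where
  "inv_word w = rev (map inv_letter w)"

abbreviation reduced :: "('a \<times> bool) list \<Rightarrow> bool" where
  "reduced \<equiv> successively (\<lambda>x y. y \<noteq> inv_letter x)"

text \<open>
  Right multiplication of a reduced word by a letter in a free group.
\<close>

definition push :: "('a \<times> bool) list \<Rightarrow> 'a \<times> bool \<Rightarrow> ('a \<times> bool) list" where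
  "push w x = (if w \<noteq> [] \<and> last w = inv_letter x then butlast w else w @ [x])"

lemma push_snoc [simp]: "push (w @ [y]) x = (if y = inv_letter x then w else w @ [y, x])"
  and push_Nil [simp]: "push [] x = [x]"
  by (auto simp: push_def)

lemma reduced_snoc_snoc [simp]:
  "reduced (w @ [y, x]) \<longleftrightarrow> reduced (w @ [y]) \<and> x \<noteq> inv_letter y"
  by (auto simp: successively_append_iff)

lemma reduced_push: "reduced w \<Longrightarrow> reduced (push w x)"
  by (cases w rule: rev_cases) (auto simp: successively_append_iff)

text \<open>
  Van der Waerden's argument: the letters act on reduced words by permutations, inverse letters by
  inverse permutations, so the free group acts without any appeal to confluence of cancellation. On
  \<open>x x\<^sup>-\<^sup>1\<close>, which is not reduced, the claim would fail.
\<close>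

lemma push_push_inv: "reduced w \<Longrightarrow> push (push w x) (inv_letter x) = w"
proof (cases w rule: rev_cases)
  case (snoc v y)
  assume "reduced w"
  then show ?thesis using snoc by (cases v rule: rev_cases) (auto simp: push_def butlast_append)
qed (auto simp: push_def)

lemma length_push: "length (push w x) \<le> Suc (length w)"
  by (cases w rule: rev_cases) auto

lemma set_push: "set (push w x) \<subseteq> insert x (set w)"
  by (cases w rule: rev_cases) auto

lemma fold_push_reduced:
  "reduced (v @ w) \<Longrightarrow> fold (\<lambda>x w. push w x) w v = v @ w"
proof (induction w arbitrary: v)
  case (Cons x w)
  have "push v x = v @ [x]"
    using Cons.prems by (cases v rule: rev_cases) (auto simp: successively_append_iff)
  then show ?case using Cons.IH[of "v @ [x]"] Cons.prems by simp
qed simp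

lemma reduced_inv_word: "reduced w \<Longrightarrow> reduced (inv_word w)"
  unfolding inv_word_def successively_rev successively_map
  by (erule successively_mono) (auto simp: eq_inv_letter_iff)

text \<open>
  In \<open>(p u)\<^sup>-\<^sup>1 (p v)\<close> the prefix \<open>p\<close> cancels and then nothing else does. This is why distances in a free
  group are determined by lengths and common prefixes.
\<close>

lemma reduced_inv_append:
  assumes "reduced (p @ u)" "reduced (p @ v)" "u = [] \<or> v = [] \<or> hd u \<noteq> hd v"
  shows "reduced (inv_word u @ v)"
proof -
  have "reduced u" "reduced v"
    using assms(1,2) by (auto simp: successively_append_iff)
  then show ?thesis
    using assms(3) reduced_inv_word[of u]
    by (cases u) (auto simp: successively_append_iff successively_Cons inv_word_def last_rev)
qed

lemma longest_common_prefix_append: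
  obtains u v where "xs = longest_common_prefix xs ys @ u" "ys = longest_common_prefix xs ys @ v"
    "u = [] \<or> v = [] \<or> hd u \<noteq> hd v"
proof -
  have "\<exists>u v. xs = longest_common_prefix xs ys @ u \<and> ys = longest_common_prefix xs ys @ v \<and>
      (u = [] \<or> v = [] \<or> hd u \<noteq> hd v)"
    by (induction xs ys rule: longest_common_prefix.induct) auto
  then show thesis using that by blast
qed

lemma take_prefix_eq: "prefix p ys \<Longrightarrow> n \<le> length p \<Longrightarrow> take n ys = take n p"
  by (auto simp: prefix_def)

text \<open>
  The length of the common prefix is the Gromov product of a tree, so this is its four-point
  inequality.
\<close>

lemma longest_common_prefix_ultrametric:
  "min (length (longest_common_prefix xs ys)) (length (longest_common_prefix ys zs))
     \<le> length (longest_common_prefix xs zs)"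
proof -
  let ?p = "longest_common_prefix xs ys" and ?q = "longest_common_prefix ys zs"
  let ?n = "min (length ?p) (length ?q)"
  have 1: "take ?n ys = take ?n ?p"
    by (rule take_prefix_eq[OF longest_common_prefix_prefix2]) simp
  have 2: "take ?n ys = take ?n ?q"
    by (rule take_prefix_eq[OF longest_common_prefix_prefix1]) simp
  have "prefix (take ?n ys) xs"
    unfolding 1 using longest_common_prefix_prefix1[of xs ys] take_is_prefix prefix_order.trans by blast
  moreover have "prefix (take ?n ys) zs"
    unfolding 2 using longest_common_prefix_prefix2[of ys zs] take_is_prefix prefix_order.trans by blast
  ultimately have "prefix (take ?n ys) (longest_common_prefix xs zs)"
    by (rule longest_common_prefix_max_prefix)
  then have "length (take ?n ys) \<le> length (longest_common_prefix xs zs)"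
    by (rule prefix_length_le)
  moreover have "length ?p \<le> length ys"
    using longest_common_prefix_prefix2 prefix_length_le by blast
  ultimately show ?thesis by simp
qed

section \<open>The extension of a free group by a swap\<close>

text \<open>
  The letters \<open>A i\<close>, \<open>B i\<close> and \<open>C i\<close> stand for \<open>a\<^sub>i\<close>, \<open>b\<^sub>i\<close> and \<open>e b\<^sub>i e\<close>.
\<close>

datatype gen = A nat | B nat | C nat

text \<open>
  Conjugation by \<open>e\<close>. As it permutes the letters, it preserves reducedness and length of words.
\<close>

primrec swap_gen :: "gen \<Rightarrow> gen" where
  "swap_gen (A i) = A i"
| "swap_gen (B i) = C i"
| "swap_gen (C i) = B i"

definition twist :: "bool \<Rightarrow> gen \<times> bool \<Rightarrow> gen \<times> bool" where
  "twist s x = (if s then (swap_gen (fst x), snd x) else x)"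

lemma swap_gen_swap_gen [simp]: "swap_gen (swap_gen x) = x"
  by (cases x) auto

lemma swap_gen_eq_iff [simp]: "swap_gen x = swap_gen y \<longleftrightarrow> x = y"
  using swap_gen_swap_gen by metis

lemma twist_simps [simp]:
  "twist False x = x" "twist s (twist s x) = x" "twist s (inv_letter x) = inv_letter (twist s x)"
  "twist s x = twist s y \<longleftrightarrow> x = y" "twist s (A i, t) = (A i, t)"
  "twist True (B i, t) = (C i, t)" "twist True (C i, t) = (B i, t)"
  "snd (twist s x) = snd x"
  by (auto simp: twist_def inv_letter_def prod_eq_iff)

primrec gen_index :: "gen \<Rightarrow> nat" where
  "gen_index (A i) = i"
| "gen_index (B i) = i"
| "gen_index (C i) = i"

lemma gen_index_swap_gen [simp]: "gen_index (swap_gen x) = gen_index x"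
  by (cases x) auto

lemma gen_index_twist [simp]: "gen_index (fst (twist s x)) = gen_index (fst x)"
  by (simp add: twist_def)

definition letters :: "nat \<Rightarrow> (gen \<times> bool) set" where
  "letters n = {x. gen_index (fst x) < n}"

lemma mem_letters [simp]: "x \<in> letters n \<longleftrightarrow> gen_index (fst x) < n"
  by (simp add: letters_def)

lemma letters_cases:
  assumes "x \<in> letters n"
  obtains i s where "i < n" "x = (A i, s)" | i s where "i < n" "x = (B i, s)"
    | i s where "i < n" "x = (C i, s)"
  using assms by (cases x; cases "fst x") auto

lemma image_subset_letters [simp]:
  "twist s ` X \<subseteq> letters n \<longleftrightarrow> X \<subseteq> letters n" "inv_letter ` X \<subseteq> letters n \<longleftrightarrow> X \<subseteq> letters n"
  by (simp_all add: image_subset_iff subset_eq)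

text \<open>
  The pair \<open>(w, s)\<close> stands for the element \<open>w e\<^sup>s\<close>. Multiplying it by a letter \<open>x\<close> from the right means
  moving \<open>x\<close> past \<open>e\<^sup>s\<close>, which yields \<open>w (twist s x) e\<^sup>s\<close>.
\<close>

definition normal_forms :: "nat \<Rightarrow> ((gen \<times> bool) list \<times> bool) set" where
  "normal_forms n = {(w, s). reduced w \<and> set w \<subseteq> letters n}"

lemma push_normal_form:
  "(w, s) \<in> normal_forms n \<Longrightarrow> x \<in> letters n \<Longrightarrow> (push w x, t) \<in> normal_forms n"
  using set_push[of w x] by (auto simp: normal_forms_def reduced_push)

abbreviation base :: "(gen \<times> bool) list \<times> bool" where
  "base \<equiv> ([], False)"

lemma base_normal_form [simp]: "base \<in> normal_forms n"
  by (simp add: normal_forms_def)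

text \<open>
  What has to be known about the group. The action shows that different normal forms denote different
  elements, and the hypothesis on generators shows that they exhaust the group; together they make
  the group the semidirect product described above.
\<close>

locale swap_extension = group G for G (structure) +
  fixes n :: nat and a b :: "nat \<Rightarrow> 'a" and e :: 'a
    and act :: "'a \<Rightarrow> (gen \<times> bool) list \<times> bool \<Rightarrow> (gen \<times> bool) list \<times> bool"
  assumes a_closed [simp]: "i < n \<Longrightarrow> a i \<in> carrier G"
    and b_closed [simp]: "i < n \<Longrightarrow> b i \<in> carrier G"
    and e_closed [simp]: "e \<in> carrier G"
    and e_e [simp]: "e \<otimes> e = \<one>"
    and e_a: "i < n \<Longrightarrow> e \<otimes> a i = a i \<otimes> e"
    and generated: "generate G (a ` {..<n} \<union> b ` {..<n} \<union> {e}) = carrier G"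
    and act_closed: "g \<in> carrier G \<Longrightarrow> p \<in> normal_forms n \<Longrightarrow> act g p \<in> normal_forms n"
    and act_mult: "g \<in> carrier G \<Longrightarrow> h \<in> carrier G \<Longrightarrow> p \<in> normal_forms n \<Longrightarrow>
      act (g \<otimes> h) p = act h (act g p)"
    and act_one: "p \<in> normal_forms n \<Longrightarrow> act \<one> p = p"
    and act_a: "i < n \<Longrightarrow> (w, s) \<in> normal_forms n \<Longrightarrow> act (a i) (w, s) = (push w (A i, True), s)"
    and act_b: "i < n \<Longrightarrow> (w, s) \<in> normal_forms n \<Longrightarrow>
      act (b i) (w, s) = (push w (twist s (B i, True)), s)"
    and act_e: "(w, s) \<in> normal_forms n \<Longrightarrow> act e (w, s) = (w, \<not> s)"
begin

lemma inv_e [simp]: "inv e = e"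
  by (rule inv_equality) auto

primrec gen_value :: "gen \<Rightarrow> 'a" where
  "gen_value (A i) = a i"
| "gen_value (B i) = b i"
| "gen_value (C i) = e \<otimes> b i \<otimes> e"

definition letter_value :: "gen \<times> bool \<Rightarrow> 'a" where
  "letter_value x = (if snd x then gen_value (fst x) else inv (gen_value (fst x)))"

abbreviation flip_value :: "bool \<Rightarrow> 'a" where
  "flip_value s \<equiv> (if s then e else \<one>)"

definition word_value :: "(gen \<times> bool) list \<Rightarrow> 'a" where
  "word_value w = foldr (\<lambda>x g. letter_value x \<otimes> g) w \<one>"

definition element :: "(gen \<times> bool) list \<times> bool \<Rightarrow> 'a" where
  "element p = word_value (fst p) \<otimes> flip_value (snd p)"

lemma letter_value_closed [simp]: "x \<in> letters n \<Longrightarrow> letter_value x \<in> carrier G"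
  by (erule letters_cases) (auto simp: letter_value_def)

lemma letter_value_inv [simp]:
  "x \<in> letters n \<Longrightarrow> letter_value (inv_letter x) = inv (letter_value x)"
  by (erule letters_cases) (auto simp: letter_value_def)

text \<open>
  Each positive letter satisfies this by the choice of \<open>C\<close>; taking inverses gives the negative ones.
\<close>

lemma e_letter_value:
  assumes "x \<in> letters n"
  shows "e \<otimes> letter_value x = letter_value (twist True x) \<otimes> e"
proof -
  have conj: "e \<otimes> inv g = inv h \<otimes> e" if "g \<in> carrier G" "h \<in> carrier G" "e \<otimes> g = h \<otimes> e" for g h
  proof -
    have "inv g \<otimes> e = inv (e \<otimes> g)" using that(1) by (simp add: inv_mult_group)
    also have "\<dots> = e \<otimes> inv h" using that(2) by (simp add: that(3) inv_mult_group)
    finally have "inv g \<otimes> e = e \<otimes> inv h" .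
    then have "e \<otimes> (inv g \<otimes> e) \<otimes> e = e \<otimes> (e \<otimes> inv h) \<otimes> e" by simp
    then have "(e \<otimes> inv g) \<otimes> (e \<otimes> e) = (e \<otimes> e) \<otimes> inv h \<otimes> e"
      using that by (simp add: m_assoc del: e_e)
    then show ?thesis using that by simp
  qed
  have c: "e \<otimes> (e \<otimes> b i \<otimes> e) = b i \<otimes> e" "e \<otimes> b i \<otimes> e \<otimes> e = e \<otimes> b i" if "i < n" for i
    using that by (simp_all add: m_assoc[symmetric]) (simp add: m_assoc)
  show ?thesis
    using assms
    by (cases rule: letters_cases)
      (auto simp: letter_value_def twist_def e_a c intro!: conj)
qed

lemma word_value_simps [simp]:
  "word_value [] = \<one>" "word_value (x # w) = letter_value x \<otimes> word_value w"
  by (simp_all add: word_value_def)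

lemma word_value_closed [simp]: "set w \<subseteq> letters n \<Longrightarrow> word_value w \<in> carrier G"
  by (induction w) auto

lemma word_value_append:
  "set v \<subseteq> letters n \<Longrightarrow> set w \<subseteq> letters n \<Longrightarrow> word_value (v @ w) = word_value v \<otimes> word_value w"
  by (induction v) (auto simp: m_assoc)

lemma word_value_inv:
  "set w \<subseteq> letters n \<Longrightarrow> word_value (inv_word w) = inv (word_value w)"
proof (induction w)
  case (Cons x w)
  then show ?case
    by (simp add: inv_word_def word_value_append inv_mult_group)
qed (simp add: inv_word_def)

lemma flip_word_value:
  "set w \<subseteq> letters n \<Longrightarrow>
     flip_value s \<otimes> word_value w = word_value (map (twist s) w) \<otimes> flip_value s"
proof (induction w)
  case (Cons x w)
  show ?case
  proof (cases s)
    case True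
    have "e \<otimes> (letter_value x \<otimes> word_value w) = (e \<otimes> letter_value x) \<otimes> word_value w"
      using Cons by (simp add: m_assoc)
    also have "\<dots> = letter_value (twist True x) \<otimes> (e \<otimes> word_value w)"
      using Cons by (simp add: m_assoc e_letter_value)
    finally show ?thesis
      using Cons True by (auto simp: m_assoc)
  next
    case False
    then show ?thesis using Cons by (auto simp: twist_def)
  qed
qed simp

lemma word_value_push:
  assumes "set w \<subseteq> letters n" "x \<in> letters n"
  shows "word_value (push w x) = word_value w \<otimes> letter_value x"
proof (cases w rule: rev_cases)
  case (snoc v y)
  then show ?thesis
    using assms by (auto simp: word_value_append m_assoc)
qed (use assms in auto)

lemma inv_act: 
  assumes "g \<in> carrier G" "p \<in> normal_forms n"
  shows "act g (act (inv g) p) = p"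
  using act_mult[of "inv g" g p] assms act_one by simp

text \<open>
  Inverse generators act by inverse permutations, and these are pushes of inverse letters.
\<close>

lemma act_inverse_push:
  assumes g: "g \<in> carrier G" and x: "x \<in> letters n"
    and *: "\<And>w s. (w, s) \<in> normal_forms n \<Longrightarrow> act g (w, s) = (push w (twist s x), s)"
    and p: "(w, s) \<in> normal_forms n"
  shows "act (inv g) (w, s) = (push w (twist s (inv_letter x)), s)"
proof -
  let ?q = "(push w (twist s (inv_letter x)), s)"
  have q: "?q \<in> normal_forms n" using p x by (intro push_normal_form) auto
  have "act g ?q = (w, s)"
    using *[OF q] p push_push_inv[of w "inv_letter (twist s x)"] by (simp add: normal_forms_def)
  then show ?thesis
    using act_mult[of g "inv g" ?q] act_one g q by simp
qed

lemma act_letter_value: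
  assumes x: "x \<in> letters n" and p: "(w, s) \<in> normal_forms n"
  shows "act (letter_value x) (w, s) = (push w (twist s x), s)"
proof -
  have positive: "act (letter_value (y, True)) (w, s) = (push w (twist s (y, True)), s)"
    if "(y, True) \<in> letters n" "(w, s) \<in> normal_forms n" for y w s
    using that(1)
  proof (cases rule: letters_cases)
    case (3 i t)
    have q: "(w, \<not> s) \<in> normal_forms n" using that(2) by (simp add: normal_forms_def)
    have "(push w (twist (\<not> s) (B i, True)), \<not> s) \<in> normal_forms n"
      using q 3 by (intro push_normal_form) auto
    then show ?thesis
      using 3 that(2) q by (cases s) (auto simp: letter_value_def act_mult act_e act_b act_closed)
  qed (use that in \<open>auto simp: letter_value_def act_a act_b\<close>)
  show ?thesis
  proof (cases "snd x")
    case True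
    then show ?thesis using positive[of "fst x" w s] x p by (cases x) auto
  next
    case False
    define y where "y = (fst x, True)"
    have x': "inv_letter y = x" and y: "y \<in> letters n"
      using False x by (auto simp: prod_eq_iff y_def inv_letter_def)
    have "act (inv (letter_value y)) (w, s) = (push w (twist s (inv_letter y)), s)"
      by (rule act_inverse_push[OF letter_value_closed[OF y] y _ p])
        (use positive[of "fst x"] y in \<open>auto simp: y_def\<close>)
    then show ?thesis using x' letter_value_inv[OF y] by simp
  qed
qed

lemma act_word_value:
  assumes "set w \<subseteq> letters n" "(v, False) \<in> normal_forms n"
  shows "act (word_value w) (v, False) = (fold (\<lambda>x w. push w x) w v, False)"
  using assms
proof (induction w arbitrary: v)
  case (Cons x w)
  then show ?case
    using push_normal_form[of v False n x False] by (simp add: act_mult act_letter_value)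
qed (simp add: act_one)

lemma act_element:
  assumes "p \<in> normal_forms n"
  shows "act (element p) base = p"
proof -
  have p: "reduced (fst p)" "set (fst p) \<subseteq> letters n" using assms by (auto simp: normal_forms_def)
  then have "act (word_value (fst p)) base = (fst p, False)"
    using act_word_value[of "fst p" "[]"] fold_push_reduced[of "[]" "fst p"] by simp
  moreover have "(fst p, False) \<in> normal_forms n" using p by (simp add: normal_forms_def)
  ultimately show ?thesis
    using p by (cases p) (auto simp: element_def act_mult act_e act_one)
qed

lemma element_closed [simp]: "p \<in> normal_forms n \<Longrightarrow> element p \<in> carrier G"
  by (auto simp: element_def normal_forms_def)

lemma generators_induct:
  assumes "subgroup H G" "a ` {..<n} \<subseteq> H" "b ` {..<n} \<subseteq> H" "e \<in> H"
  shows "H = carrier G"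
  using generate_subgroup_incl[OF _ assms(1), of "a ` {..<n} \<union> b ` {..<n} \<union> {e}"] assms generated
    subgroup.subset[OF assms(1)] by auto

text \<open>
  The elements \<open>g\<close> with this property form a subgroup, and it contains the generators. For \<open>p = base\<close>
  it says that every element is the one denoted by its normal form.
\<close>

lemma element_act_mult:
  assumes "g \<in> carrier G" "p \<in> normal_forms n"
  shows "element (act g p) = element p \<otimes> g"
proof -
  let ?H = "{g \<in> carrier G. \<forall>p\<in>normal_forms n. element (act g p) = element p \<otimes> g}"
  have "?H = carrier G"
  proof (rule generators_induct)
    show "subgroup ?H G"
    proof (rule subgroupI)
      fix g assume g: "g \<in> ?H"
      have "element (act (inv g) p) = element p \<otimes> inv g" if p: "p \<in> normal_forms n" for p
      proof -
        have q: "act (inv g) p \<in> normal_forms n" using g p by (simp add: act_closed)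
        have "element p = element (act (inv g) p) \<otimes> g"
          using g q p inv_act[of g p] by auto
        then show ?thesis using g q p by (simp add: m_assoc)
      qed
      then show "inv g \<in> ?H" using g by auto
    next
      show "?H \<noteq> {}" by (auto simp: act_one intro!: exI[of _ \<one>])
    qed (auto simp: act_mult act_closed m_assoc)
    have letter: "element (act (letter_value x) p) = element p \<otimes> letter_value x"
      if x: "x \<in> letters n" and p: "p \<in> normal_forms n" for x p
    proof -
      obtain w s where w: "p = (w, s)" "set w \<subseteq> letters n" using p by (auto simp: normal_forms_def)
      have "element (act (letter_value x) p) = word_value w \<otimes> letter_value (twist s x) \<otimes> flip_value s"
        using act_letter_value[OF x] w p x by (simp add: element_def word_value_push)
      also have "\<dots> = word_value w \<otimes> flip_value s \<otimes> letter_value x"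
        using w(2) x e_letter_value[OF x] by (auto simp: m_assoc)
      finally show ?thesis by (simp add: element_def w)
    qed
    show "a ` {..<n} \<subseteq> ?H" using letter[of "(A _, True)"] by (auto simp: letter_value_def)
    show "b ` {..<n} \<subseteq> ?H" using letter[of "(B _, True)"] by (auto simp: letter_value_def)
    show "e \<in> ?H" by (auto simp: element_def act_e m_assoc normal_forms_def)
  qed
  then show ?thesis using assms by blast
qed

definition nf :: "'a \<Rightarrow> (gen \<times> bool) list \<times> bool" where
  "nf g = act g base"

lemma nf_normal_form [simp]: "g \<in> carrier G \<Longrightarrow> nf g \<in> normal_forms n"
  by (simp add: nf_def act_closed)

lemma element_nf [simp]: "g \<in> carrier G \<Longrightarrow> element (nf g) = g"
  by (simp add: nf_def element_act_mult) (simp add: element_def)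

lemma nf_element [simp]: "p \<in> normal_forms n \<Longrightarrow> nf (element p) = p"
  by (simp add: nf_def act_element)

lemma nf_mult: "g \<in> carrier G \<Longrightarrow> h \<in> carrier G \<Longrightarrow> nf (g \<otimes> h) = act h (nf g)"
  by (simp add: nf_def act_mult)

end

section \<open>Hyperbolicity\<close>

lemma twist_eq_inv_letter_iff [simp]:
  "twist s y = inv_letter (twist s x) \<longleftrightarrow> y = inv_letter x"
  using twist_simps(3,4) by metis

lemma reduced_map_twist [simp]: "reduced (map (twist s) w) \<longleftrightarrow> reduced w"
  by (simp add: successively_map)

lemma finite_letters: "finite (letters n)"
proof (rule finite_subset)
  show "letters n \<subseteq> (A ` {..<n} \<union> B ` {..<n} \<union> C ` {..<n}) \<times> UNIV"
    by (auto elim!: letters_cases simp del: mem_letters)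
qed auto

lemma half_sum_close:
  fixes d1 d2 d3 t1 t2 t3 :: real
  assumes "t1 \<le> d1" "d1 \<le> t1 + 1" "t2 \<le> d2" "d2 \<le> t2 + 1" "t3 \<le> d3" "d3 \<le> t3 + 1"
  shows "\<bar>(d1 + d2 - d3) / 2 - (t1 + t2 - t3) / 2\<bar> \<le> 1"
  using assms by (simp add: abs_le_iff field_simps)

context swap_extension
begin

definition len :: "'a \<Rightarrow> nat" where
  "len g = length (fst (nf g))"

text \<open>
  It turns out to be the Gromov product of \<open>g\<close> and \<open>h\<close> for the metric defined by \<open>len\<close>.
\<close>

definition overlap :: "'a \<Rightarrow> 'a \<Rightarrow> nat" where
  "overlap g h = length (longest_common_prefix (fst (nf g)) (fst (nf h)))"

text \<open>
  If \<open>g = p u e\<^sup>s\<close> and \<open>h = p v e\<^sup>t\<close> with \<open>p\<close> the longest common prefix, then \<open>g\<^sup>-\<^sup>1 h\<close> is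
  \<open>e\<^sup>s u\<^sup>-\<^sup>1 v e\<^sup>t\<close>, and moving \<open>e\<^sup>s\<close> to the right only permutes the letters of the reduced word \<open>u\<^sup>-\<^sup>1 v\<close>.
\<close>

lemma len_inv_mult:
  assumes g: "g \<in> carrier G" and h: "h \<in> carrier G"
  shows "len (inv g \<otimes> h) + 2 * overlap g h = len g + len h"
proof -
  obtain w s w' t where nf: "nf g = (w, s)" "nf h = (w', t)" by (metis surj_pair)
  define p where "p = longest_common_prefix w w'"
  obtain u v where uv: "w = p @ u" "w' = p @ v" "u = [] \<or> v = [] \<or> hd u \<noteq> hd v"
    unfolding p_def by (rule longest_common_prefix_append)
  have "(w, s) \<in> normal_forms n" "(w', t) \<in> normal_forms n"
    using nf_normal_form g h nf by metis+
  then have red: "reduced (p @ u)" "reduced (p @ v)"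
    and sets: "set p \<subseteq> letters n" "set u \<subseteq> letters n" "set v \<subseteq> letters n"
    by (auto simp: normal_forms_def uv)
  have "set (inv_word u) \<subseteq> letters n"
    using sets by (simp add: inv_word_def)
  define q where "q = (map (twist s) (inv_word u @ v), s \<noteq> t)"
  have sets': "set (inv_word u @ v) \<subseteq> letters n"
    using sets by (simp add: inv_word_def)
  have q: "q \<in> normal_forms n"
    using sets' reduced_inv_append[OF red uv(3)]
    unfolding q_def normal_forms_def by (simp only: mem_Collect_eq prod.case reduced_map_twist) simp
  have W: "word_value (map (twist s) (inv_word u @ v)) \<in> carrier G"
    using sets' by (intro word_value_closed) (simp only: set_map image_subset_letters)
  have "element q = word_value (map (twist s) (inv_word u @ v)) \<otimes> flip_value (s \<noteq> t)"
    by (simp only: element_def q_def fst_conv snd_conv)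
  also have "\<dots> = word_value (map (twist s) (inv_word u @ v)) \<otimes> (flip_value s \<otimes> flip_value t)"
    using sets' by (cases s; cases t; simp)
  also have "\<dots> = flip_value s \<otimes> word_value (inv_word u @ v) \<otimes> flip_value t"
    using sets' W by (simp add: flip_word_value[OF sets', of s] m_assoc del: map_append)
  also have "\<dots> = inv g \<otimes> h"
  proof -
    have gh: "g = word_value p \<otimes> word_value u \<otimes> flip_value s"
      "h = word_value p \<otimes> word_value v \<otimes> flip_value t"
      using element_nf[OF g] element_nf[OF h] sets unfolding nf uv
      by (simp_all add: element_def word_value_append)
    have "word_value (inv_word u @ v) = inv (word_value u) \<otimes> word_value v"
      using sets \<open>set (inv_word u) \<subseteq> letters n\<close> by (simp add: word_value_append word_value_inv)
    moreover have "inv (word_value p) \<otimes> (word_value p \<otimes> x) = x" if "x \<in> carrier G" for x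
      using that sets by (simp add: m_assoc[symmetric])
    ultimately show ?thesis
      unfolding gh using sets by (simp add: inv_mult_group m_assoc)
  qed
  finally have "nf (inv g \<otimes> h) = q"
    using nf_element[OF q] by simp
  moreover have "overlap g h = length p"
    by (simp add: overlap_def nf p_def)
  ultimately show ?thesis
    using nf uv(1,2) by (simp add: len_def q_def inv_word_def)
qed

lemma nf_one: "nf \<one> = base"
  by (simp add: nf_def act_one)

lemma len_inv: "g \<in> carrier G \<Longrightarrow> len (inv g) = len g"
  using len_inv_mult[of g \<one>] by (simp add: overlap_def nf_one len_def)

text \<open>
  The elements \<open>c\<^sub>i = e b\<^sub>i e\<close> are included as generators. Without them an alternating product of \<open>b\<^sub>i\<close> and
  \<open>c\<^sub>i\<close> would need a letter \<open>e\<close> at each change, and word length would not stay close to \<open>len\<close>.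
\<close>

definition letter_set :: "'a set" where
  "letter_set = letter_value ` letters n \<union> {e}"

lemma letter_set_closed: "letter_set \<subseteq> carrier G"
  by (auto simp: letter_set_def)

lemma letter_value_in_letter_set: "x \<in> letters n \<Longrightarrow> letter_value x \<in> letter_set"
  by (simp add: letter_set_def)

lemma inv_letter_set: "m_inv G ` letter_set \<subseteq> letter_set"
proof
  fix g assume "g \<in> m_inv G ` letter_set"
  then consider "g = e" | x where "x \<in> letters n" "g = inv (letter_value x)"
    by (auto simp: letter_set_def)
  then show "g \<in> letter_set"
  proof cases
    case (2 x)
    then have "letter_value (inv_letter x) \<in> letter_set"
      by (intro letter_value_in_letter_set) simp
    then show ?thesis using 2 by simp
  qed (simp add: letter_set_def)
qed

lemma generating_letter_set: "generating_set G letter_set"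
proof -
  have "a i \<in> letter_set" "b i \<in> letter_set" if "i < n" for i
    using that letter_value_in_letter_set[of "(A i, True)"] letter_value_in_letter_set[of "(B i, True)"]
    by (simp_all add: letter_value_def)
  then have "a ` {..<n} \<subseteq> letter_set" "b ` {..<n} \<subseteq> letter_set" "e \<in> letter_set"
    by (auto simp: letter_set_def)
  then have "generate G letter_set = carrier G"
    using generate.incl[of _ letter_set G]
    by (intro generators_induct generate_is_subgroup letter_set_closed) auto
  then show ?thesis by (simp add: generating_set_def letter_set_closed)
qed

lemma nf_mult_letter:
  assumes "g \<in> carrier G" "x \<in> letters n"
  shows "nf (g \<otimes> letter_value x) = (push (fst (nf g)) (twist (snd (nf g)) x), snd (nf g))"
  using assms nf_normal_form[of g] by (cases "nf g") (simp add: nf_mult act_letter_value)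

lemma nf_mult_e:
  assumes "g \<in> carrier G"
  shows "nf (g \<otimes> e) = (fst (nf g), \<not> snd (nf g))"
  using assms nf_normal_form[of g] by (cases "nf g") (simp add: nf_mult act_e)

lemma len_mult_letter_set:
  assumes "g \<in> carrier G" "x \<in> letter_set"
  shows "len (g \<otimes> x) \<le> len g + 1"
  using assms
  by (auto simp: letter_set_def len_def nf_mult_e nf_mult_letter intro!: length_push)

lemma len_mult_product:
  assumes "g \<in> carrier G" "set xs \<subseteq> letter_set"
  shows "len (g \<otimes> foldr (\<otimes>) xs \<one>) \<le> len g + length xs"
  using assms
proof (induction xs arbitrary: g)
  case (Cons x xs)
  have closed: "foldr (\<otimes>) ys \<one> \<in> carrier G" if "set ys \<subseteq> letter_set" for ys
    using that letter_set_closed by (induction ys) auto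
  have "g \<otimes> foldr (\<otimes>) (x # xs) \<one> = (g \<otimes> x) \<otimes> foldr (\<otimes>) xs \<one>"
    using Cons.prems closed[of xs] letter_set_closed by (auto simp: m_assoc)
  moreover have "len ((g \<otimes> x) \<otimes> foldr (\<otimes>) xs \<one>) \<le> len (g \<otimes> x) + length xs"
    using Cons letter_set_closed by auto
  ultimately show ?case
    using len_mult_letter_set[of g x] Cons.prems by simp
qed simp

lemma word_length_bounds:
  assumes g: "g \<in> carrier G"
  shows "len g \<le> word_length G letter_set g" "word_length G letter_set g \<le> len g + 1"
proof -
  let ?P = "\<lambda>k. \<exists>xs. length xs = k \<and> set xs \<subseteq> letter_set \<union> m_inv G ` letter_set \<and>
    foldr (\<otimes>) xs \<one> = g"
  obtain w s where nf: "nf g = (w, s)" by (metis surj_pair)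
  have w: "set w \<subseteq> letters n"
    using nf_normal_form[OF g] by (simp add: nf normal_forms_def)
  let ?xs = "map letter_value w @ (if s then [e] else [])"
  have "foldr (\<otimes>) (map letter_value w @ ys) \<one> = word_value w \<otimes> foldr (\<otimes>) ys \<one>"
    if "foldr (\<otimes>) ys \<one> \<in> carrier G" for ys
    using that w by (induction w) (auto simp: m_assoc)
  then have "foldr (\<otimes>) ?xs \<one> = g"
    using element_nf[OF g] by (auto simp: nf element_def)
  moreover have "set ?xs \<subseteq> letter_set"
    using w by (auto simp: letter_set_def)
  moreover have "length ?xs \<le> len g + 1"
    by (simp add: len_def nf)
  ultimately have "\<exists>k\<le>len g + 1. ?P k"
    by (intro exI[of _ "length ?xs"] conjI exI[of _ ?xs]) auto
  then obtain k where k: "k \<le> len g + 1" "?P k" by blast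
  have "word_length G letter_set g \<le> k"
    unfolding word_length_def by (rule Least_le) (fact k(2))
  then show "word_length G letter_set g \<le> len g + 1"
    using k(1) by linarith
  have "?P (word_length G letter_set g)"
    unfolding word_length_def by (rule LeastI[of ?P]) (fact k(2))
  then obtain xs where "length xs = word_length G letter_set g" "set xs \<subseteq> letter_set"
    "foldr (\<otimes>) xs \<one> = g"
    using inv_letter_set by blast
  then show "len g \<le> word_length G letter_set g"
    using len_mult_product[of \<one> xs] g by (simp add: len_def nf_one)
qed

lemma gromov_product_tree:
  assumes "w \<in> carrier G" "x \<in> carrier G" "y \<in> carrier G"
  shows "gromov_product (\<lambda>x y. real (len (inv x \<otimes> y))) w x y = real (overlap (inv w \<otimes> x) (inv w \<otimes> y))"
proof -
  have "inv (inv w \<otimes> x) \<otimes> (inv w \<otimes> y) = inv x \<otimes> y"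
  proof -
    have "w \<otimes> (inv w \<otimes> y) = y" using assms by (simp add: m_assoc[symmetric])
    then show ?thesis using assms by (simp add: inv_mult_group m_assoc)
  qed
  moreover have "len (inv x \<otimes> w) = len (inv w \<otimes> x)" "len (inv y \<otimes> w) = len (inv w \<otimes> y)"
    using len_inv[of "inv w \<otimes> x"] len_inv[of "inv w \<otimes> y"] assms by (simp_all add: inv_mult_group)
  ultimately show ?thesis
    using len_inv_mult[of "inv w \<otimes> x" "inv w \<otimes> y"] assms
    by (simp add: gromov_product_def)
qed

text \<open>
  The metric given by \<open>len\<close> is a tree metric, so it satisfies the four-point inequality without error.
  Word distance exceeds it by at most \<open>1\<close>, which moves each Gromov product by at most \<open>1\<close>; hence the
  constant \<open>3\<close> suffices.
\<close>

theorem hyperbolic: "hyperbolic_group G"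
proof -
  have "gromov_hyperbolic (carrier G) (word_dist G letter_set) 3"
    unfolding gromov_hyperbolic_def
  proof (intro ballI)
    fix w x y z assume c: "w \<in> carrier G" "x \<in> carrier G" "y \<in> carrier G" "z \<in> carrier G"
    let ?t = "\<lambda>x y. real (len (inv x \<otimes> y))"
    have near: "?t x y \<le> word_dist G letter_set x y" "word_dist G letter_set x y \<le> ?t x y + 1"
      if "x \<in> carrier G" "y \<in> carrier G" for x y
      using word_length_bounds[of "inv x \<otimes> y"] that by (auto simp: word_dist_def)
    have close: "\<bar>gromov_product (word_dist G letter_set) w x y - gromov_product ?t w x y\<bar> \<le> 1"
      if "x \<in> carrier G" "y \<in> carrier G" for x y
      using near[OF that(1) c(1)] near[OF that(2) c(1)] near[OF that]
      unfolding gromov_product_def by (rule half_sum_close)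
    have "min (gromov_product ?t w x y) (gromov_product ?t w y z) \<le> gromov_product ?t w x z"
      using c longest_common_prefix_ultrametric
      by (simp add: gromov_product_tree overlap_def flip: of_nat_min)
    then show "min (gromov_product (word_dist G letter_set) w x y)
        (gromov_product (word_dist G letter_set) w y z) - 3
      \<le> gromov_product (word_dist G letter_set) w x z"
      using close[OF c(2,3)] close[OF c(3,4)] close[OF c(2,4)] by (simp add: min_def abs_le_iff split: if_splits)
  qed
  moreover have "finite letter_set"
    by (simp add: letter_set_def finite_letters)
  ultimately show ?thesis
    using generating_letter_set is_group unfolding hyperbolic_group_def by blast
qed

end

section \<open>Counting trivial words\<close>

lemma finite_words [simp]: "finite (words m l)"
  unfolding words_def by (rule finite_lists_length_eq) auto

lemma card_words: "card (words m l) = (2 * m) ^ l"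
  unfolding words_def by (subst card_lists_length_eq) (auto simp: card_UNIV_bool mult.commute)

lemma words_0: "words m 0 = {[]}"
  by (auto simp: words_def)

lemma words_Suc: "words m (Suc l) = case_prod (#) ` (({..<m} \<times> UNIV) \<times> words m l)"
proof -
  have "w \<in> case_prod (#) ` (({..<m} \<times> UNIV) \<times> words m l)" if "w \<in> words m (Suc l)" for w
    using that by (cases w) (auto simp: words_def image_iff)
  then show ?thesis by (auto simp: words_def)
qed

lemma sum_words_Suc:
  "(\<Sum>w\<in>words m (Suc l). h w) = (\<Sum>x\<in>{..<m} \<times> UNIV. \<Sum>w\<in>words m l. h (x # w))"
proof -
  have "(\<Sum>w\<in>words m (Suc l). h w) = (\<Sum>(x, w)\<in>({..<m} \<times> UNIV) \<times> words m l. h (x # w))"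
    unfolding words_Suc by (subst sum.reindex) (auto simp: inj_on_def case_prod_beta)
  then show ?thesis by (simp add: sum.cartesian_product)
qed

lemma append_words: "v \<in> words m k \<Longrightarrow> w \<in> words m l \<Longrightarrow> v @ w \<in> words m (k + l)"
  by (auto simp: words_def)

context group
begin

abbreviation signed :: "'a list \<Rightarrow> nat \<times> bool \<Rightarrow> 'a" where
  "signed gens x \<equiv> (case x of (i, s) \<Rightarrow> if s then gens ! i else inv (gens ! i))"

lemma eval_word_simps [simp]:
  "eval_word G gens [] = \<one>" "eval_word G gens (x # w) = signed gens x \<otimes> eval_word G gens w"
  by (simp_all add: eval_word_def)

lemma signed_closed:
  "set gens \<subseteq> carrier G \<Longrightarrow> fst x < length gens \<Longrightarrow> signed gens x \<in> carrier G"
  by (cases x) (auto simp: subset_iff)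

lemma eval_word_closed:
  "set gens \<subseteq> carrier G \<Longrightarrow> set w \<subseteq> {..<length gens} \<times> UNIV \<Longrightarrow> eval_word G gens w \<in> carrier G"
proof (induction w)
  case (Cons x w)
  then show ?case using signed_closed[of gens x] by (cases x) auto
qed simp

lemma eval_word_append:
  assumes "set gens \<subseteq> carrier G" "set v \<subseteq> {..<length gens} \<times> UNIV"
    "set w \<subseteq> {..<length gens} \<times> UNIV"
  shows "eval_word G gens (v @ w) = eval_word G gens v \<otimes> eval_word G gens w"
  using assms(2)
proof (induction v)
  case (Cons x v)
  then show ?case
    using signed_closed[of gens x] eval_word_closed[of gens v] eval_word_closed[of gens w] assms
    by (cases x) (auto simp: m_assoc)
qed (use eval_word_closed[of gens w] assms in simp)

definition trivial_words :: "'a list \<Rightarrow> nat \<Rightarrow> (nat \<times> bool) list set" where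
  "trivial_words gens l = {w \<in> words (length gens) l. eval_word G gens w = \<one>}"

lemma finite_trivial_words [simp]: "finite (trivial_words gens l)"
  by (simp add: trivial_words_def)

text \<open>
  Prepending a letter to the words is one step of the walk, and each step costs a factor \<open>\<Lambda>\<close>.
\<close>

lemma sum_words_superharmonic:
  fixes f :: "'a \<Rightarrow> real"
  assumes gens: "set gens \<subseteq> carrier G" and "\<Lambda> \<ge> 0"
    and step: "\<And>g. g \<in> carrier G \<Longrightarrow>
      (\<Sum>t\<leftarrow>gens. f (g \<otimes> t) + f (g \<otimes> inv t)) \<le> \<Lambda> * f g"
    and g: "g \<in> carrier G"
  shows "(\<Sum>w\<in>words (length gens) l. f (g \<otimes> eval_word G gens w)) \<le> \<Lambda> ^ l * f g"
  using g
proof (induction l arbitrary: g)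
  case (Suc l)
  let ?m = "length gens"
  have "(\<Sum>w\<in>words ?m (Suc l). f (g \<otimes> eval_word G gens w))
      = (\<Sum>x\<in>{..<?m} \<times> UNIV. \<Sum>w\<in>words ?m l. f (g \<otimes> (signed gens x \<otimes> eval_word G gens w)))"
    by (simp add: sum_words_Suc)
  also have "\<dots> = (\<Sum>x\<in>{..<?m} \<times> UNIV. \<Sum>w\<in>words ?m l. f ((g \<otimes> signed gens x) \<otimes> eval_word G gens w))"
  proof (intro sum.cong refl)
    fix x w assume "x \<in> {..<?m} \<times> (UNIV :: bool set)" "w \<in> words ?m l"
    then have "signed gens x \<in> carrier G" "eval_word G gens w \<in> carrier G"
      using signed_closed[OF gens, of x] eval_word_closed[OF gens, of w] by (auto simp: words_def)
    then show "f (g \<otimes> (signed gens x \<otimes> eval_word G gens w))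
        = f ((g \<otimes> signed gens x) \<otimes> eval_word G gens w)"
      using Suc.prems by (simp add: m_assoc)
  qed
  also have "\<dots> \<le> (\<Sum>x\<in>{..<?m} \<times> UNIV. \<Lambda> ^ l * f (g \<otimes> signed gens x))"
  proof (intro sum_mono Suc.IH)
    fix x assume "x \<in> {..<?m} \<times> (UNIV :: bool set)"
    then show "g \<otimes> signed gens x \<in> carrier G"
      using signed_closed[OF gens, of x] Suc.prems by auto
  qed
  also have "\<dots> = \<Lambda> ^ l * (\<Sum>i<?m. f (g \<otimes> gens ! i) + f (g \<otimes> inv (gens ! i)))"
    by (subst sum.cartesian_product')
      (simp add: UNIV_bool sum_distrib_left[symmetric] add.commute)
  also have "(\<Sum>i<?m. f (g \<otimes> gens ! i) + f (g \<otimes> inv (gens ! i)))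
      = (\<Sum>t\<leftarrow>gens. f (g \<otimes> t) + f (g \<otimes> inv t))"
    by (simp add: sum_list_sum_nth atLeast0LessThan)
  also have "\<Lambda> ^ l * \<dots> \<le> \<Lambda> ^ l * (\<Lambda> * f g)"
    using step[OF Suc.prems] \<open>\<Lambda> \<ge> 0\<close> by (intro mult_left_mono) auto
  finally show ?case by (simp add: mult_ac)
qed (simp add: words_0)

text \<open>
  Each trivial word contributes \<open>f \<one>\<close> to the sum over all words, and the other words contribute
  something positive.
\<close>

lemma card_trivial_words_le:
  fixes f :: "'a \<Rightarrow> real"
  assumes gens: "set gens \<subseteq> carrier G" and "\<Lambda> \<ge> 0"
    and step: "\<And>g. g \<in> carrier G \<Longrightarrow>
      (\<Sum>t\<leftarrow>gens. f (g \<otimes> t) + f (g \<otimes> inv t)) \<le> \<Lambda> * f g"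
    and f: "\<And>g. f g > 0"
  shows "real (card (trivial_words gens l)) \<le> \<Lambda> ^ l"
proof -
  have "real (card (trivial_words gens l)) * f \<one>
      = (\<Sum>w\<in>trivial_words gens l. f (\<one> \<otimes> eval_word G gens w))"
    by (simp add: trivial_words_def)
  also have "\<dots> \<le> (\<Sum>w\<in>words (length gens) l. f (\<one> \<otimes> eval_word G gens w))"
    using f by (intro sum_mono2) (auto simp: trivial_words_def less_imp_le)
  also have "\<dots> \<le> \<Lambda> ^ l * f \<one>"
    using assms by (intro sum_words_superharmonic) auto
  finally show ?thesis
    using f[of \<one>] by simp
qed

lemma card_trivial_words_add:
  assumes gens: "set gens \<subseteq> carrier G"
  shows "card (trivial_words gens k) * card (trivial_words gens l) \<le> card (trivial_words gens (k + l))"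
proof -
  have "inj_on (\<lambda>(v, w). v @ w) (trivial_words gens k \<times> trivial_words gens l)"
    by (auto simp: inj_on_def trivial_words_def words_def)
  moreover have "(\<lambda>(v, w). v @ w) ` (trivial_words gens k \<times> trivial_words gens l)
      \<subseteq> trivial_words gens (k + l)"
    using eval_word_append[OF gens] append_words
    by (auto simp: trivial_words_def words_def)
  ultimately have "card (trivial_words gens k \<times> trivial_words gens l) \<le> card (trivial_words gens (k + l))"
    by (intro card_inj_on_le) auto
  then show ?thesis by (simp add: card_cartesian_product)
qed

lemma card_trivial_words_even_pos:
  assumes gens: "set gens \<subseteq> carrier G" "gens \<noteq> []"
  shows "card (trivial_words gens (2 * k)) \<ge> 1"
proof (induction k)
  case 0
  have "[] \<in> trivial_words gens 0" by (simp add: trivial_words_def words_def)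
  then show ?case by (auto simp: Suc_le_eq card_gt_0_iff)
next
  case (Suc k)
  have "hd gens \<in> carrier G" using gens hd_in_set by blast
  have "[(0, True), (0, False)] \<in> trivial_words gens 2"
    using \<open>hd gens \<in> carrier G\<close> gens(2) by (auto simp: trivial_words_def words_def hd_conv_nth[symmetric])
  then have "card (trivial_words gens 2) \<ge> 1" by (auto simp: Suc_le_eq card_gt_0_iff)
  then have "1 \<le> card (trivial_words gens 2) * card (trivial_words gens (2 * k))"
    using Suc by simp
  also have "\<dots> \<le> card (trivial_words gens (2 * Suc k))"
    using card_trivial_words_add[OF gens(1), of 2 "2 * k"] by simp
  finally show ?case .
qed

end

text \<open>
  The limit is the supremum \<open>L\<close> of the quotients: if \<open>u p / p\<close> is close to \<open>L\<close>, then writing \<open>k\<close> as a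
  multiple of \<open>p\<close> plus a remainder gives \<open>u k / k \<ge> u p / p - u p / k\<close>.
\<close>

lemma fekete_superadditive:
  fixes u :: "nat \<Rightarrow> real"
  assumes super: "\<And>i j. u i + u j \<le> u (i + j)" and nonneg: "\<And>k. 0 \<le> u k"
    and bound: "\<And>k. u k \<le> c * real k"
  shows "convergent (\<lambda>k. u k / real k)"
proof -
  define L where "L = (SUP k\<in>{1..}. u k / real k)"
  have le_c: "u k / real k \<le> c" if "k \<ge> 1" for k
    using bound[of k] that by (simp add: field_simps)
  then have bdd: "bdd_above ((\<lambda>k. u k / real k) ` {1..})"
    by (intro bdd_aboveI2) auto
  have multiple: "real q * u p \<le> u (q * p)" for q p
  proof (induction q)
    case (Suc q)
    then show ?case using super[of p "q * p"] by (simp add: algebra_simps)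
  qed (use nonneg in simp)
  have "(\<lambda>k. u k / real k) \<longlonglongrightarrow> L"
  proof (rule LIMSEQ_I)
    fix \<epsilon> :: real assume "\<epsilon> > 0"
    then have "L - \<epsilon> / 2 < L" by simp
    then obtain p where p: "p \<ge> 1" "L - \<epsilon> / 2 < u p / real p"
      unfolding L_def using less_cSUP_iff[OF _ bdd, of "L - \<epsilon> / 2"] by (auto simp: L_def)
    obtain N where N: "real N > 2 * u p / \<epsilon>" using reals_Archimedean2 by blast
    have "norm (u k / real k - L) < \<epsilon>" if k: "k \<ge> max 1 N" for k
    proof -
      have "u k / real k \<le> L"
        unfolding L_def using k by (intro cSUP_upper bdd) auto
      moreover have "u p / real p - u p / real k \<le> u k / real k"
      proof -
        have "real (k div p) * u p \<le> u (k div p * p)" by (rule multiple)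
        also have "\<dots> \<le> u k"
          using super[of "k div p * p" "k mod p"] nonneg[of "k mod p"] by simp
        finally have "real (k div p) * u p \<le> u k" .
        moreover
        have "real k = real (k div p) * real p + real (k mod p)" "k mod p < p"
          using p(1) by (simp_all flip: of_nat_mult of_nat_add)
        then have "real k / real p - 1 \<le> real (k div p)"
          using p(1) by (simp add: field_simps)
        then have "(real k / real p - 1) * u p \<le> real (k div p) * u p"
          using nonneg by (rule mult_right_mono)
        ultimately have "(real k / real p - 1) * u p \<le> u k" by linarith
        then have "(real k / real p - 1) * u p / real k \<le> u k / real k"
          by (rule divide_right_mono) simp
        then show ?thesis using k p(1) by (simp add: field_simps)
      qed
      moreover have "u p / real k < \<epsilon> / 2"
      proof -
        have "2 * u p / \<epsilon> < real k" using N k by linarith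
        then show ?thesis using \<open>\<epsilon> > 0\<close> k by (simp add: field_simps)
      qed
      ultimately show ?thesis using p(2) by (simp add: abs_less_iff)
    qed
    then show "\<exists>no. \<forall>k\<ge>no. norm (u k / real k - L) < \<epsilon>" by blast
  qed
  then show ?thesis by (rule convergentI)
qed

context group
begin

text \<open>
  Concatenation makes the logarithms of the counts superadditive, so the limit exists. In even lengths
  there is always a trivial word, so all these logarithms are nonnegative.
\<close>

lemma has_gross_cogrowth_exists:
  assumes gens: "set gens \<subseteq> carrier G" "gens \<noteq> []"
    and bound: "\<And>l. real (card (trivial_words gens l)) \<le> \<Lambda> ^ l" "\<Lambda> > 0"
  obtains \<theta> where "has_gross_cogrowth G gens \<theta>" "\<theta> \<le> log (2 * real (length gens)) \<Lambda>"
proof -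
  define M where "M = 2 * real (length gens)"
  have M: "M > 1"
  proof -
    have "length gens \<ge> 1" using gens(2) by (cases gens) auto
    then show ?thesis unfolding M_def by linarith
  qed
  define u where "u k = log M (real (card (trivial_words gens (2 * k))))" for k
  have pos: "real (card (trivial_words gens (2 * k))) \<ge> 1" for k
    using card_trivial_words_even_pos[OF gens, of k] by simp
  have le: "u k \<le> 2 * log M \<Lambda> * real k" for k
  proof -
    have "u k \<le> log M (\<Lambda> ^ (2 * k))"
      unfolding u_def using pos[of k] bound M by (subst log_le_cancel_iff) (auto intro: less_le_trans[of 0 1])
    also have "\<dots> = 2 * log M \<Lambda> * real k"
      using bound(2) by (simp add: log_nat_power)
    finally show ?thesis .
  qed
  have "convergent (\<lambda>k. u k / real k)"
  proof (rule fekete_superadditive[OF _ _ le])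
    fix i j
    have "u i + u j = log M (real (card (trivial_words gens (2 * i)) * card (trivial_words gens (2 * j))))"
      unfolding u_def using pos[of i] pos[of j] M by (auto simp: log_mult)
    also have "\<dots> \<le> u (i + j)"
    proof -
      have "card (trivial_words gens (2 * i)) * card (trivial_words gens (2 * j))
          \<le> card (trivial_words gens (2 * (i + j)))"
        using card_trivial_words_add[OF gens(1), of "2 * i" "2 * j"] by (simp add: distrib_left)
      moreover have "card (trivial_words gens (2 * i)) * card (trivial_words gens (2 * j)) > 0"
        using card_trivial_words_even_pos[OF gens, of i] card_trivial_words_even_pos[OF gens, of j]
        by simp
      ultimately show ?thesis
        unfolding u_def using M by (subst log_le_cancel_iff) (simp_all only: of_nat_le_iff of_nat_0_less_iff)
    qed
    finally show "u i + u j \<le> u (i + j)" .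
    show "0 \<le> u i"
      unfolding u_def using pos[of i] M by (subst zero_le_log_cancel_iff) linarith+
  qed
  then obtain x where x: "(\<lambda>k. u k / real k) \<longlonglongrightarrow> x"
    by (auto simp: convergent_def)
  have "(\<lambda>k. u k / real k / 2) \<longlonglongrightarrow> x / 2"
    by (intro tendsto_divide x tendsto_const) simp
  then have "has_gross_cogrowth G gens (x / 2)"
    unfolding has_gross_cogrowth_def u_def trivial_words_def M_def by (simp add: mult.commute)
  moreover have "x \<le> 2 * log M \<Lambda>"
  proof (rule LIMSEQ_le_const2[OF x], intro exI[of _ 1] allI impI)
    fix k :: nat assume "1 \<le> k"
    then show "u k / real k \<le> 2 * log M \<Lambda>" using le[of k] by (simp add: field_simps)
  qed
  ultimately show thesis using that[of "x / 2"] by (simp add: M_def)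
qed

end

section \<open>A superharmonic function\<close>

text \<open>
  The inverse pair \<open>d\<^sub>i = c\<^sub>i b\<^sub>i\<^sup>-\<^sup>1\<close>, \<open>d\<^sub>i\<^sup>-\<^sup>1 = b\<^sub>i c\<^sub>i\<^sup>-\<^sup>1\<close> consists of two-letter words. Counting \<open>a\<^sub>i\<close> twice
  makes the \<open>a\<^sub>i\<close> and the \<open>d\<^sub>i\<close> equally long, so that all of them can be treated alike.
\<close>

primrec gen_weight :: "gen \<Rightarrow> nat" where
  "gen_weight (A i) = 2"
| "gen_weight (B i) = 1"
| "gen_weight (C i) = 1"

definition decay :: "(gen \<times> bool) list \<Rightarrow> real" where
  "decay w = (1 / 2) ^ (\<Sum>x\<leftarrow>w. gen_weight (fst x))"

lemma decay_simps [simp]: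
  "decay [] = 1" "decay (v @ w) = decay v * decay w"
  "decay [x] = (1 / 2) ^ gen_weight (fst x)"
  "decay (x # w) = (1 / 2) ^ gen_weight (fst x) * decay w"
  by (simp_all add: decay_def power_add)

lemma decay_pos [simp]: "decay w > 0"
  by (simp add: decay_def)

lemma decay_push_le: "decay (push w x) \<le> 2 ^ gen_weight (fst x) * decay w"
proof (cases w rule: rev_cases)
  case (snoc v y)
  have "(1 / 2) ^ k \<le> (2 :: real) ^ k" for k
    by (rule power_mono) auto
  then have "decay w * (1 / 2) ^ k \<le> 2 ^ k * decay w" for k
    by (subst mult.commute, intro mult_right_mono) (auto simp: less_imp_le)
  then show ?thesis
    using snoc by (auto simp: power_one_over field_simps)
qed (auto simp: power_one_over divide_le_eq_1 intro: one_le_power order_trans[of _ 1])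

definition cancels :: "(gen \<times> bool) list \<Rightarrow> gen \<times> bool \<Rightarrow> real" where
  "cancels w x = of_bool (w \<noteq> [] \<and> last w = inv_letter x)"

text \<open>
  Appending a word of weight \<open>2\<close> divides \<open>decay\<close> by \<open>4\<close>, cancelling one multiplies it by \<open>4 = 1/4 + 15/4\<close>.
\<close>

lemma decay_push_A: "decay (push w (A i, s)) = decay w * (1 / 4 + 15 / 4 * cancels w (A i, s))"
  by (cases w rule: rev_cases) (auto simp: cancels_def power2_eq_square)

text \<open>
  If \<open>x\<close> cancels, the second letter may or may not do so as well, whence only an inequality. If \<open>x\<close> does
  not cancel, neither does \<open>y\<close>, because \<open>x y\<close> is reduced.
\<close>

lemma decay_push_push:
  assumes "fst x \<noteq> fst y" "gen_weight (fst x) = 1" "gen_weight (fst y) = 1"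
  shows "decay (push (push w x) y) \<le> decay w * (1 / 4 + 15 / 4 * cancels w x)"
proof (cases "w \<noteq> [] \<and> last w = inv_letter x")
  case True
  then obtain v where v: "w = v @ [inv_letter x]"
    by (metis append_butlast_last_id)
  then have "decay (push (push w x) y) \<le> 2 * decay v"
    using decay_push_le[of v y] assms by simp
  then show ?thesis using v assms by (simp add: cancels_def)
next
  case False
  then have "push w x = w @ [x]" by (auto simp: push_def)
  moreover have "x \<noteq> inv_letter y" using assms(1) by auto
  ultimately show ?thesis using assms(2,3) by (simp add: cancels_def False)
qed

text \<open>
  The \<open>4n\<close> words \<open>a\<^sub>i\<^sup>\<plusminus>\<^sup>1\<close>, \<open>d\<^sub>i\<^sup>\<plusminus>\<^sup>1\<close> start with different letters, so at most one of them cancels against the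
  end of \<open>w\<close>.
\<close>

lemma sum_cancels_le:
  "(\<Sum>i<n. cancels w (A i, True) + cancels w (A i, False) + cancels w (B i, True) + cancels w (C i, True)) \<le> 1"
proof (cases w rule: rev_cases)
  case (snoc v y)
  have delta: "(\<Sum>i<n. of_bool (j = i) :: real) \<le> 1" for j
    by (simp add: of_bool_def sum.delta)
  obtain g s where "y = (g, s)" by (metis surj_pair)
  then show ?thesis
    using snoc delta by (cases g; cases s) (auto simp: cancels_def)
qed (simp add: cancels_def)

text \<open>
  The usual estimate for a free group of rank \<open>2n\<close>: one of the \<open>4n\<close> neighbours is nearer to the origin
  and contributes a factor \<open>4\<close>, the others contribute \<open>1/4\<close> each, and \<open>4 + (4n - 1)/4 = n + 15/4\<close>.
\<close>

lemma sum_decay_le: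
  "(\<Sum>i<n. decay (push w (A i, True)) + decay (push w (A i, False))
      + decay (push (push w (B i, True)) (C i, False))
      + decay (push (push w (C i, True)) (B i, False))) \<le> (real n + 15 / 4) * decay w"
proof -
  let ?c = "\<lambda>i. cancels w (A i, True) + cancels w (A i, False) + cancels w (B i, True) + cancels w (C i, True)"
  have "decay (push w (A i, True)) + decay (push w (A i, False))
      + decay (push (push w (B i, True)) (C i, False))
      + decay (push (push w (C i, True)) (B i, False)) \<le> decay w * (1 + 15 / 4 * ?c i)" for i
    using decay_push_A[of w i True] decay_push_A[of w i False]
      decay_push_push[of "(B i, True)" "(C i, False)" w] decay_push_push[of "(C i, True)" "(B i, False)" w]
    by (simp add: algebra_simps)
  then have "(\<Sum>i<n. decay (push w (A i, True)) + decay (push w (A i, False))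
      + decay (push (push w (B i, True)) (C i, False))
      + decay (push (push w (C i, True)) (B i, False))) \<le> (\<Sum>i<n. decay w * (1 + 15 / 4 * ?c i))"
    by (rule sum_mono)
  also have "\<dots> = decay w * (real n + 15 / 4 * (\<Sum>i<n. ?c i))"
    by (simp only: sum_distrib_left[symmetric] sum.distrib[of "\<lambda>_. 1"]) simp
  also have "\<dots> \<le> decay w * (real n + 15 / 4 * 1)"
    using sum_cancels_le[of w n] by (intro mult_left_mono add_left_mono) (auto simp: less_imp_le)
  finally show ?thesis by (simp add: mult.commute)
qed

lemma sum_list_concat_replicate:
  "(\<Sum>x\<leftarrow>concat (replicate k xs). h x) = real k * (\<Sum>x\<leftarrow>xs. h x)"
  by (induction k) (auto simp: algebra_simps)

lemma length_concat_replicate: "length (concat (replicate k xs)) = k * length xs"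
  by (induction k) auto

lemma set_concat_replicate: "set (concat (replicate k xs)) \<subseteq> set xs"
  by (induction k) auto

context swap_extension
begin

text \<open>
  The commutator of \<open>e\<close> and \<open>b\<^sub>i\<close>.
\<close>

definition d :: "nat \<Rightarrow> 'a" where
  "d i = e \<otimes> b i \<otimes> e \<otimes> inv (b i)"

lemma d_closed [simp]: "i < n \<Longrightarrow> d i \<in> carrier G"
  by (simp add: d_def)

text \<open>
  The \<open>a\<^sub>i\<close> and \<open>d\<^sub>i\<close> determine the growth rates when \<open>k\<close> is large; the \<open>b\<^sub>i\<close> and \<open>e\<close> are added to make the list
  generate the group.
\<close>

definition walk_gens :: "nat \<Rightarrow> 'a list" where
  "walk_gens k = concat (replicate k (map a [0..<n])) @ concat (replicate k (map d [0..<n]))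
     @ map b [0..<n] @ [e]"

lemma length_walk_gens: "length (walk_gens k) = 2 * k * n + n + 1"
  by (simp add: walk_gens_def length_concat_replicate)

lemma walk_gens_closed: "set (walk_gens k) \<subseteq> carrier G"
  using set_concat_replicate[of k "map a [0..<n]"] set_concat_replicate[of k "map d [0..<n]"]
  by (auto simp: walk_gens_def subset_iff simp del: set_concat)

lemma generating_walk_gens:
  assumes "k > 0"
  shows "generating_set G (set (walk_gens k))"
proof -
  have "a ` {..<n} \<subseteq> set (walk_gens k)" "b ` {..<n} \<subseteq> set (walk_gens k)" "e \<in> set (walk_gens k)"
    using assms by (auto simp: walk_gens_def)
  then have "generate G (set (walk_gens k)) = carrier G"
    using generate.incl[of _ "set (walk_gens k)" G]
    by (intro generators_induct generate_is_subgroup walk_gens_closed) auto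
  then show ?thesis by (simp add: generating_set_def walk_gens_closed)
qed

definition decay_nf :: "'a \<Rightarrow> real" where
  "decay_nf g = decay (fst (nf g))"

lemma decay_nf_letter:
  assumes "g \<in> carrier G" "x \<in> letters n"
  shows "decay_nf (g \<otimes> letter_value x) = decay (push (fst (nf g)) (twist (snd (nf g)) x))"
  using assms by (simp add: decay_nf_def nf_mult_letter)

lemma decay_nf_letter_letter:
  assumes "g \<in> carrier G" "x \<in> letters n" "y \<in> letters n"
  shows "decay_nf (g \<otimes> (letter_value x \<otimes> letter_value y))
    = decay (push (push (fst (nf g)) (twist (snd (nf g)) x)) (twist (snd (nf g)) y))"
proof -
  have "g \<otimes> (letter_value x \<otimes> letter_value y) = (g \<otimes> letter_value x) \<otimes> letter_value y"
    using assms by (simp add: m_assoc)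
  then show ?thesis
    using assms by (simp add: decay_nf_letter nf_mult_letter)
qed

text \<open>
  Multiplication by \<open>b\<^sub>i\<^sup>\<plusminus>\<^sup>1\<close> at most doubles \<open>decay_nf\<close>, and \<open>e\<close> does not change it; the \<open>a\<^sub>i\<close> and \<open>d\<^sub>i\<close> are covered
  by \<open>sum_decay_le\<close>.
\<close>

lemma sum_walk_gens_le:
  assumes g: "g \<in> carrier G"
  shows "(\<Sum>t\<leftarrow>walk_gens k. decay_nf (g \<otimes> t) + decay_nf (g \<otimes> inv t))
    \<le> (real k * (real n + 15 / 4) + 4 * real n + 2) * decay_nf g"
proof -
  let ?h = "\<lambda>t. decay_nf (g \<otimes> t) + decay_nf (g \<otimes> inv t)"
  obtain w s where nf: "nf g = (w, s)" by (metis surj_pair)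
  have letter: "decay_nf (g \<otimes> letter_value x) = decay (push w (twist s x))" if "x \<in> letters n" for x
    using decay_nf_letter[OF g that] by (simp add: nf)
  have letter2: "decay_nf (g \<otimes> (letter_value x \<otimes> letter_value y)) = decay (push (push w (twist s x)) (twist s y))"
    if "x \<in> letters n" "y \<in> letters n" for x y
    using decay_nf_letter_letter[OF g that] by (simp add: nf)
  have a: "?h (a i) = decay (push w (A i, True)) + decay (push w (A i, False))" if "i < n" for i
    using letter[of "(A i, True)"] letter[of "(A i, False)"] that by (simp add: letter_value_def)
  have d: "?h (d i) = decay (push (push w (B i, True)) (C i, False))
      + decay (push (push w (C i, True)) (B i, False))" if "i < n" for i
  proof -
    have "d i = letter_value (C i, True) \<otimes> letter_value (B i, False)"
      "inv (d i) = letter_value (B i, True) \<otimes> letter_value (C i, False)"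
      using that by (simp_all add: d_def letter_value_def inv_mult_group)
    \<comment> \<open>If \<open>s\<close> holds, then \<open>d\<^sub>i\<close> and \<open>d\<^sub>i\<^sup>-\<^sup>1\<close> push each other's word, which leaves the sum unchanged.\<close>
    then show ?thesis
      using letter2[of "(C i, True)" "(B i, False)"] letter2[of "(B i, True)" "(C i, False)"] that
      by (cases s) simp_all
  qed
  have "(\<Sum>i<n. ?h (a i)) + (\<Sum>i<n. ?h (d i)) = (\<Sum>i<n. ?h (a i) + ?h (d i))"
    by (rule sum.distrib[symmetric])
  also have "\<dots> = (\<Sum>i<n. decay (push w (A i, True)) + decay (push w (A i, False))
      + decay (push (push w (B i, True)) (C i, False))
      + decay (push (push w (C i, True)) (B i, False)))"
  proof (rule sum.cong[OF refl])
    fix i assume "i \<in> {..<n}"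
    then have "i < n" by simp
    then show "?h (a i) + ?h (d i) = decay (push w (A i, True)) + decay (push w (A i, False))
      + decay (push (push w (B i, True)) (C i, False))
      + decay (push (push w (C i, True)) (B i, False))"
      unfolding a[OF \<open>i < n\<close>] d[OF \<open>i < n\<close>] by simp
  qed
  also have "\<dots> \<le> (real n + 15 / 4) * decay w"
    by (rule sum_decay_le)
  finally have heavy: "(\<Sum>i<n. ?h (a i)) + (\<Sum>i<n. ?h (d i)) \<le> (real n + 15 / 4) * decay w" .
  have "?h (b i) \<le> 4 * decay w" if "i < n" for i
    using letter[of "(B i, True)"] letter[of "(B i, False)"] that
      decay_push_le[of w "twist s (B i, True)"] decay_push_le[of w "twist s (B i, False)"]
    by (cases s) (simp_all add: letter_value_def)
  then have b: "(\<Sum>i<n. ?h (b i)) \<le> real n * (4 * decay w)"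
    using sum_bounded_above[of "{..<n}" "\<lambda>i. ?h (b i)" "4 * decay w"] by simp
  have e: "?h e = 2 * decay w"
    using g by (simp add: decay_nf_def nf_mult_e nf)
  have "(\<Sum>t\<leftarrow>walk_gens k. ?h t)
      = real k * ((\<Sum>i<n. ?h (a i)) + (\<Sum>i<n. ?h (d i))) + (\<Sum>i<n. ?h (b i)) + ?h e"
    by (simp only: walk_gens_def map_append sum_list_append sum_list_concat_replicate map_map
        interv_sum_list_conv_sum_set_nat atLeast0LessThan set_upt comp_def)
      (simp add: algebra_simps)
  also have "\<dots> \<le> real k * ((real n + 15 / 4) * decay w) + real n * (4 * decay w) + 2 * decay w"
    by (intro add_mono mult_left_mono heavy b) (use e in auto)
  finally show ?thesis
    by (simp add: decay_nf_def nf algebra_simps)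
qed

lemma card_trivial_walk_words_le:
  "real (card (trivial_words (walk_gens k) l)) \<le> (real k * (real n + 15 / 4) + 4 * real n + 2) ^ l"
  by (rule card_trivial_words_le[OF walk_gens_closed _ sum_walk_gens_le])
    (auto simp: decay_nf_def)

end

section \<open>Random words hit prescribed cosets\<close>

text \<open>
  Independence of the entries.
\<close>

lemma prob_replicate_pmf_avoid:
  fixes p :: "'a :: countable pmf"
  shows "measure_pmf.prob (replicate_pmf N p) {xs. set xs \<inter> X = {}} = (1 - measure_pmf.prob p X) ^ N"
proof (induction N)
  case (Suc N)
  have "replicate_pmf (Suc N) p = map_pmf (\<lambda>(x, xs). x # xs) (pair_pmf p (replicate_pmf N p))"
    by (simp add: pair_pmf_def map_bind_pmf)
  moreover have "(\<lambda>(x, xs). x # xs) -` {xs. set xs \<inter> X = {}} = (- X) \<times> {xs. set xs \<inter> X = {}}"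
    by auto
  moreover have "measure_pmf.prob p (- X) = 1 - measure_pmf.prob p X"
    using measure_pmf.prob_compl[of X p] by (simp add: Compl_eq_Diff_UNIV)
  ultimately show ?case
    using Suc by (simp add: measure_pmf_prob_product)
qed simp

definition words_ending_in :: "(nat \<times> bool) set \<Rightarrow> nat \<Rightarrow> nat \<Rightarrow> (nat \<times> bool) list set" where
  "words_ending_in T j l = (\<lambda>w. w @ [(j, True)]) ` {w. set w \<subseteq> T \<and> length w = l - 1}"

lemma prob_words_ending_in:
  assumes T: "T \<subseteq> {..<m} \<times> UNIV" and j: "j < m" and l: "l \<ge> 1"
  shows "measure_pmf.prob (pmf_of_set (words m l)) (words_ending_in T j l)
    = real (card T) ^ (l - 1) / (2 * real m) ^ l"
proof -
  have "finite T" using T finite_subset by fastforce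
  then have "card (words_ending_in T j l) = card T ^ (l - 1)"
    unfolding words_ending_in_def by (subst card_image) (auto simp: inj_on_def card_lists_length_eq)
  moreover have "words_ending_in T j l \<subseteq> words m l"
    using T j l by (auto simp: words_ending_in_def words_def)
  then have "words m l \<inter> words_ending_in T j l = words_ending_in T j l" by blast
  moreover have "words m l \<noteq> {}"
    using card_words[of m l] j by (metis card.empty less_nat_zero_code mult_eq_0_iff power_eq_0_iff zero_neq_numeral)
  ultimately show ?thesis
    by (simp add: measure_pmf_of_set card_words)
qed

text \<open>
  With \<open>p = t\<^sup>l\<^sup>-\<^sup>1 / M\<^sup>l\<close> and \<open>N\<close> the exponent, \<open>(1 - p)\<^sup>N \<le> exp (- N p)\<close>, and \<open>N p\<close> is about
  \<open>(t / \<tau>)\<^sup>l / t\<close>; rounding \<open>N\<close> down costs at most \<open>p \<le> 1\<close>.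
\<close>

lemma miss_probability_tendsto_0:
  fixes t \<tau> M :: real
  assumes "0 < \<tau>" "\<tau> < t" "1 \<le> t" "t \<le> M"
  shows "(\<lambda>l. (1 - t ^ (l - 1) / M ^ l) ^ nat \<lfloor>(M / \<tau>) ^ l\<rfloor>) \<longlonglongrightarrow> 0"
proof (rule tendsto_sandwich[OF _ _ tendsto_const])
  define p where "p l = t ^ (l - 1) / M ^ l" for l
  have p: "0 \<le> p l" "p l \<le> 1" for l
  proof -
    have "t ^ (l - 1) \<le> M ^ (l - 1)" using assms by (intro power_mono) auto
    also have "\<dots> \<le> M ^ l" using assms by (intro power_increasing) auto
    finally show "p l \<le> 1" using assms by (simp add: p_def)
  qed (use assms in \<open>simp add: p_def\<close>)
  show "\<forall>\<^sub>F l in sequentially. 0 \<le> (1 - t ^ (l - 1) / M ^ l) ^ nat \<lfloor>(M / \<tau>) ^ l\<rfloor>"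
    using p by (simp add: p_def)
  show "\<forall>\<^sub>F l in sequentially. (1 - t ^ (l - 1) / M ^ l) ^ nat \<lfloor>(M / \<tau>) ^ l\<rfloor>
      \<le> exp (1 - (t / \<tau>) ^ l / t)"
  proof (rule eventually_sequentiallyI[of 1])
    fix l :: nat assume l: "1 \<le> l"
    let ?N = "nat \<lfloor>(M / \<tau>) ^ l\<rfloor>"
    have "(1 - p l) ^ ?N \<le> exp (- p l) ^ ?N"
      using p[of l] exp_ge_add_one_self[of "- p l"] by (intro power_mono) auto
    also have "\<dots> = exp (- (real ?N * p l))"
      by (simp add: exp_of_nat_mult[symmetric])
    also have "\<dots> \<le> exp (1 - (t / \<tau>) ^ l / t)"
    proof -
      have "(M / \<tau>) ^ l - 1 \<le> real ?N" by linarith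
      then have "((M / \<tau>) ^ l - 1) * p l \<le> real ?N * p l"
        using p by (intro mult_right_mono) auto
      moreover have "(M / \<tau>) ^ l * p l = (t / \<tau>) ^ l / t"
        using assms l by (cases l) (auto simp: p_def power_divide)
      ultimately show ?thesis
        using p[of l] by (simp add: algebra_simps)
    qed
    finally show "(1 - t ^ (l - 1) / M ^ l) ^ ?N \<le> exp (1 - (t / \<tau>) ^ l / t)"
      by (simp add: p_def)
  qed
  have "1 < t / \<tau>" using assms by simp
  then have "filterlim (\<lambda>l. (t / \<tau>) ^ l) at_top sequentially"
    using assms
    by (intro filterlim_at_infinity_imp_filterlim_at_top filterlim_realpow_sequentially_gt1) auto
  then have "filterlim (\<lambda>l. (t / \<tau>) ^ l * (1 / t)) at_top sequentially"
    using assms by (intro filterlim_at_top_mult_tendsto_pos[OF tendsto_const]) auto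
  then have "filterlim (\<lambda>l. (t / \<tau>) ^ l * (1 / t) + (- 1)) at_top sequentially"
    by (subst add.commute, intro filterlim_tendsto_add_at_top[OF tendsto_const])
  then have "filterlim (\<lambda>l. - ((t / \<tau>) ^ l * (1 / t) + (- 1))) at_bot sequentially"
    by (simp add: filterlim_uminus_at_bot)
  then have "filterlim (\<lambda>l. 1 - (t / \<tau>) ^ l / t) at_bot sequentially"
    by simp
  then show "(\<lambda>l. exp (1 - (t / \<tau>) ^ l / t)) \<longlonglongrightarrow> 0"
    by (rule filterlim_compose[OF exp_at_bot])
qed

section \<open>The random quotient is finite\<close>

context group
begin

text \<open>
  Since \<open>carrier G\<close> itself is a normal subgroup containing \<open>R\<close>, the intersection is over a nonempty
  family.
\<close>

lemma normal_normal_closure: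
  assumes "R \<subseteq> carrier G"
  shows "normal_closure G R \<lhd> G" "R \<subseteq> normal_closure G R"
proof -
  have "carrier G \<lhd> G"
    by (simp add: normal_inv_iff subgroup_self)
  then have *: "carrier G \<in> {N. N \<lhd> G \<and> R \<subseteq> N}" using assms by blast
  then have "subgroup (normal_closure G R) G"
    unfolding normal_closure_def by (intro subgroups_Inter) (auto simp: normal_inv_iff)
  then show "normal_closure G R \<lhd> G"
    by (auto simp: normal_inv_iff normal_closure_def)
  show "R \<subseteq> normal_closure G R" by (auto simp: normal_closure_def)
qed

lemma eval_word_in_generate:
  assumes "set w \<subseteq> J \<times> UNIV" "\<And>j. j \<in> J \<Longrightarrow> gens ! j \<in> X"
  shows "eval_word G gens w \<in> generate G X"
  using assms(1)
proof (induction w)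
  case (Cons x w)
  then have "signed gens x \<in> generate G X"
    using assms(2) by (cases x) (auto intro: generate.incl generate.inv)
  then show ?case using Cons by (auto intro: generate.eng)
qed (simp add: generate.one)

end

context swap_extension
begin

lemma e_generate_a: "h \<in> generate G (a ` {..<n}) \<Longrightarrow> e \<otimes> h = h \<otimes> e"
proof -
  have "subgroup {h \<in> carrier G. e \<otimes> h = h \<otimes> e} G"
  proof (rule subgroupI)
    fix h assume h: "h \<in> {h \<in> carrier G. e \<otimes> h = h \<otimes> e}"
    then have hc: "h \<in> carrier G" and he: "e \<otimes> h = h \<otimes> e" by auto
    have "inv h \<otimes> e = inv (e \<otimes> h)" using hc by (simp add: inv_mult_group)
    also have "\<dots> = e \<otimes> inv h" unfolding he using hc by (simp add: inv_mult_group)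
    finally have "inv h \<otimes> e = e \<otimes> inv h" .
    then show "inv h \<in> {h \<in> carrier G. e \<otimes> h = h \<otimes> e}" using h by simp
  next
    fix g h assume "g \<in> {h \<in> carrier G. e \<otimes> h = h \<otimes> e}" "h \<in> {h \<in> carrier G. e \<otimes> h = h \<otimes> e}"
    then show "g \<otimes> h \<in> {h \<in> carrier G. e \<otimes> h = h \<otimes> e}"
      by (simp add: m_assoc[symmetric]) (simp add: m_assoc)
  qed (auto intro!: exI[of _ \<one>])
  then have "generate G (a ` {..<n}) \<subseteq> {h \<in> carrier G. e \<otimes> h = h \<otimes> e}"
    by (intro generate_subgroup_incl) (auto simp: e_a)
  then show "h \<in> generate G (a ` {..<n}) \<Longrightarrow> e \<otimes> h = h \<otimes> e" by blast
qed

text \<open>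
  Conjugating \<open>h b\<^sub>i \<in> N\<close> by \<open>e\<close>, which commutes with \<open>h\<close>, and dividing by \<open>h b\<^sub>i\<close> gives a conjugate of \<open>d\<^sub>i\<close>.
  So \<open>N\<close> contains the \<open>d\<^sub>i\<close>, then by the second hypothesis the \<open>a\<^sub>i\<close>, and then by the first the \<open>b\<^sub>i\<close>.
  Only the cosets of \<open>1\<close> and \<open>e\<close> remain.
\<close>

lemma finite_quotient:
  assumes N: "N \<lhd> G"
    and hb: "\<And>i. i < n \<Longrightarrow> \<exists>h\<in>generate G (a ` {..<n}). h \<otimes> b i \<in> N"
    and ma: "\<And>i. i < n \<Longrightarrow> \<exists>m\<in>generate G (d ` {..<n}). m \<otimes> a i \<in> N"
  shows "finite (carrier (G Mod N))"
proof -
  interpret N: normal N G by (rule N)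
  have cancel: "y \<in> N" if "x \<in> N" "x \<otimes> y \<in> N" "y \<in> carrier G" for x y
  proof -
    have "inv x \<otimes> (x \<otimes> y) \<in> N" using that by blast
    then show ?thesis using that N.mem_carrier by (simp add: m_assoc[symmetric])
  qed
  have d: "d i \<in> N" if i: "i < n" for i
  proof -
    obtain h where h: "h \<in> generate G (a ` {..<n})" "h \<otimes> b i \<in> N" using hb[OF i] by blast
    have hc: "h \<in> carrier G" by (rule generate_in_carrier[OF _ h(1)]) auto
    have "e \<otimes> (h \<otimes> b i) \<otimes> e \<in> N"
      using N.inv_op_closed2[OF e_closed h(2)] by simp
    then have "e \<otimes> (h \<otimes> b i) \<otimes> e \<otimes> inv (h \<otimes> b i) \<in> N"
      using h(2) by blast
    also have "e \<otimes> (h \<otimes> b i) \<otimes> e \<otimes> inv (h \<otimes> b i) = (e \<otimes> h) \<otimes> (b i \<otimes> e \<otimes> inv (b i)) \<otimes> inv h"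
      using i hc by (simp add: m_assoc inv_mult_group)
    also have "\<dots> = h \<otimes> d i \<otimes> inv h"
      using i hc by (simp add: e_generate_a[OF h(1)] d_def m_assoc)
    finally have "inv h \<otimes> (h \<otimes> d i \<otimes> inv h) \<otimes> h \<in> N"
      by (rule N.inv_op_closed1[OF hc])
    also have "inv h \<otimes> (h \<otimes> d i \<otimes> inv h) \<otimes> h = (inv h \<otimes> h) \<otimes> d i \<otimes> (inv h \<otimes> h)"
      using i hc by (simp only: m_assoc m_closed inv_closed d_closed)
    finally show ?thesis using i hc by simp
  qed
  then have generate_d: "generate G (d ` {..<n}) \<subseteq> N"
    by (intro generate_subgroup_incl N.subgroup_axioms) auto
  have a: "a i \<in> N" if i: "i < n" for i
  proof -
    obtain m where "m \<in> N" "m \<otimes> a i \<in> N" using ma[OF i] generate_d by blast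
    then show ?thesis by (rule cancel) (simp add: i)
  qed
  then have generate_a: "generate G (a ` {..<n}) \<subseteq> N"
    by (intro generate_subgroup_incl N.subgroup_axioms) auto
  have b: "b i \<in> N" if i: "i < n" for i
  proof -
    obtain h where "h \<in> N" "h \<otimes> b i \<in> N" using hb[OF i] generate_a by blast
    then show ?thesis by (rule cancel) (simp add: i)
  qed
  have conj: "e \<otimes> x \<otimes> e \<in> N" if "x \<in> N" for x
    using N.inv_op_closed2[OF e_closed that] by simp
  let ?K = "{g \<in> carrier G. g \<in> N \<or> g \<otimes> e \<in> N}"
  have "?K = carrier G"
  proof (rule generators_induct)
    show "subgroup ?K G"
    proof (rule subgroupI)
      fix g assume g: "g \<in> ?K"
      have "inv g \<otimes> e \<in> N" if "g \<otimes> e \<in> N"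
      proof -
        have "e \<otimes> inv (g \<otimes> e) \<otimes> e \<in> N" using that by (intro conj) blast
        also have "e \<otimes> inv (g \<otimes> e) \<otimes> e = (e \<otimes> e) \<otimes> inv g \<otimes> e"
          using g by (simp add: inv_mult_group m_assoc del: e_e)
        finally show ?thesis using g by simp
      qed
      then show "inv g \<in> ?K" using g by blast
    next
      fix g h assume gh: "g \<in> ?K" "h \<in> ?K"
      have 1: "g \<otimes> h = (g \<otimes> e) \<otimes> (e \<otimes> (h \<otimes> e) \<otimes> e)" "g \<otimes> h \<otimes> e = (g \<otimes> e) \<otimes> (e \<otimes> h \<otimes> e)"
        "g \<otimes> h \<otimes> e = g \<otimes> (h \<otimes> e)"
      proof -
        have *: "e \<otimes> (e \<otimes> x) = x" if "x \<in> carrier G" for x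
          using that by (simp add: m_assoc[symmetric])
        show "g \<otimes> h = (g \<otimes> e) \<otimes> (e \<otimes> (h \<otimes> e) \<otimes> e)" "g \<otimes> h \<otimes> e = (g \<otimes> e) \<otimes> (e \<otimes> h \<otimes> e)"
          "g \<otimes> h \<otimes> e = g \<otimes> (h \<otimes> e)"
          using gh by (simp_all add: m_assoc *)
      qed
      consider "g \<in> N" "h \<in> N" | "g \<in> N" "h \<otimes> e \<in> N" | "g \<otimes> e \<in> N" "h \<in> N" | "g \<otimes> e \<in> N" "h \<otimes> e \<in> N"
        using gh by blast
      then have "g \<otimes> h \<in> N \<or> g \<otimes> h \<otimes> e \<in> N"
      proof cases
        case 2 then show ?thesis unfolding 1(3) by blast
      next
        case 3 then show ?thesis unfolding 1(2) using conj by blast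
      next
        case 4 then show ?thesis by (subst 1(1)) (use conj in blast)
      qed blast
      then show "g \<otimes> h \<in> ?K" using gh by blast
    qed (auto intro!: exI[of _ \<one>])
  qed (use a b in auto)
  then have "N #> g \<in> {N, N #> e}" if g: "g \<in> carrier G" for g
  proof -
    consider "g \<in> N" | "g \<otimes> e \<in> N" using \<open>?K = carrier G\<close> g by blast
    then show ?thesis
    proof cases
      case 1
      then show ?thesis using N.rcos_const by (simp add: coset_join2 N.subgroup_axioms g)
    next
      case 2
      have "g = (g \<otimes> e) \<otimes> e" using g by (simp add: m_assoc)
      then have "g \<in> N #> e" using 2 by (auto simp: r_coset_def)
      then have "N #> e = N #> g"
        by (intro repr_independence N.subgroup_axioms) auto
      then show ?thesis by simp
    qed
  qed
  then have "carrier (G Mod N) \<subseteq> {N, N #> e}"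
    by (auto simp: FactGroup_def RCOSETS_def)
  then show ?thesis by (rule finite_subset) simp
qed

lemma nth_walk_gens:
  "j < k * n \<Longrightarrow> walk_gens k ! j \<in> a ` {..<n}"
  "k * n \<le> j \<Longrightarrow> j < 2 * k * n \<Longrightarrow> walk_gens k ! j \<in> d ` {..<n}"
proof -
  let ?as = "concat (replicate k (map a [0..<n]))" and ?ds = "concat (replicate k (map d [0..<n]))"
  have len: "length ?as = k * n" "length ?ds = k * n"
    by (simp_all add: length_concat_replicate)
  have sets: "set ?as \<subseteq> a ` {..<n}" "set ?ds \<subseteq> d ` {..<n}"
    using set_concat_replicate[of k "map a [0..<n]"] set_concat_replicate[of k "map d [0..<n]"]
    by (simp_all only: set_map set_upt atLeast0LessThan)
  show "walk_gens k ! j \<in> a ` {..<n}" if "j < k * n"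
  proof -
    have "walk_gens k ! j = ?as ! j"
      unfolding walk_gens_def nth_append len using that by simp
    then show ?thesis using nth_mem[of j ?as] that len sets by auto
  qed
  show "walk_gens k ! j \<in> d ` {..<n}" if "k * n \<le> j" "j < 2 * k * n"
  proof -
    have less: "j - k * n < k * n" using that by (simp add: mult.assoc)
    then have "walk_gens k ! j = ?ds ! (j - k * n)"
      unfolding walk_gens_def nth_append len using that by simp
    moreover have "j - k * n < length ?ds" using less len by simp
    ultimately show ?thesis using nth_mem[of "j - k * n" ?ds] sets by auto
  qed
qed

text \<open>
  The first \<open>k n\<close> generators are copies of the \<open>a\<^sub>j\<close> and the next \<open>k n\<close> copies of the \<open>d\<^sub>j\<close>, so the two
  kinds of words evaluate to the elements that \<open>finite_quotient\<close> asks for.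
\<close>

lemma finite_quotient_by_words:
  assumes R: "set R \<subseteq> words (length (walk_gens k)) l"
    and ja: "\<And>i. i < n \<Longrightarrow> ja i < length (walk_gens k) \<and> walk_gens k ! ja i = a i"
    and jb: "\<And>i. i < n \<Longrightarrow> jb i < length (walk_gens k) \<and> walk_gens k ! jb i = b i"
    and hit_b: "\<And>i. i < n \<Longrightarrow> set R \<inter> words_ending_in ({..<k * n} \<times> UNIV) (jb i) l \<noteq> {}"
    and hit_a: "\<And>i. i < n \<Longrightarrow> set R \<inter> words_ending_in ({k * n..<2 * k * n} \<times> UNIV) (ja i) l \<noteq> {}"
  shows "finite (carrier (quotient_by_words G (walk_gens k) R))"
proof -
  let ?g = "walk_gens k" and ?m = "length (walk_gens k)"
  let ?N = "normal_closure G (eval_word G ?g ` set R)"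
  have "eval_word G ?g ` set R \<subseteq> carrier G"
    using R eval_word_closed[OF walk_gens_closed] by (auto simp: words_def)
  note N = normal_normal_closure[OF this]
  have hit: "\<exists>h\<in>generate G X. h \<otimes> ?g ! j \<in> ?N"
    if J: "set R \<inter> words_ending_in (J \<times> UNIV) j l \<noteq> {}" "J \<subseteq> {..<?m}" "j < ?m"
      "\<And>j. j \<in> J \<Longrightarrow> ?g ! j \<in> X" for J j X
  proof -
    obtain w where w: "w @ [(j, True)] \<in> set R" "set w \<subseteq> J \<times> UNIV"
      using J(1) by (auto simp: words_ending_in_def)
    have "?g ! j \<in> carrier G" using walk_gens_closed J(3) nth_mem by blast
    have "eval_word G ?g (w @ [(j, True)]) = eval_word G ?g w \<otimes> ?g ! j"
      using eval_word_append[OF walk_gens_closed, of w k "[(j, True)]"] w J \<open>?g ! j \<in> carrier G\<close>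
      by auto
    moreover have "eval_word G ?g (w @ [(j, True)]) \<in> ?N"
      using N(2) w(1) by blast
    ultimately show ?thesis
      using eval_word_in_generate[OF w(2) J(4)] by (intro bexI[of _ "eval_word G ?g w"]) auto
  qed
  have "2 * k * n \<le> ?m" by (simp add: length_walk_gens)
  then have sub: "{..<k * n} \<subseteq> {..<?m}" "{k * n..<2 * k * n} \<subseteq> {..<?m}" by auto
  have "finite (carrier (G Mod ?N))"
  proof (rule finite_quotient[OF N(1)])
    fix i assume i: "i < n"
    show "\<exists>h\<in>generate G (a ` {..<n}). h \<otimes> b i \<in> ?N"
      using hit[OF hit_b[OF i] sub(1), of "a ` {..<n}"] nth_walk_gens(1)[of _ k] jb[OF i] by auto
    show "\<exists>h\<in>generate G (d ` {..<n}). h \<otimes> a i \<in> ?N"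
      using hit[OF hit_a[OF i] sub(2), of "d ` {..<n}"] nth_walk_gens(2)[of k] ja[OF i] by auto
  qed
  then show ?thesis by (simp add: quotient_by_words_def)
qed

end

section \<open>Failure of the phase transition\<close>

context swap_extension
begin

text \<open>
  A union bound over the \<open>2n\<close> events that one of the required kinds of words does not occur. Each kind
  comprises \<open>t\<^sup>l\<^sup>-\<^sup>1\<close> of the \<open>M\<^sup>l\<close> words.
\<close>

lemma prob_infinite_quotient_le:
  assumes k: "k > 0" and l: "l \<ge> 1"
  defines "t \<equiv> 2 * real k * real n" and "M \<equiv> 2 * real (length (walk_gens k))"
  shows "measure_pmf.prob (random_words (length (walk_gens k)) \<delta> l)
      {R. infinite (carrier (quotient_by_words G (walk_gens k) R))}
    \<le> 2 * real n * (1 - t ^ (l - 1) / M ^ l) ^ nat \<lfloor>M powr (\<delta> * real l)\<rfloor>"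
proof -
  let ?g = "walk_gens k" and ?m = "length (walk_gens k)"
  let ?N = "nat \<lfloor>M powr (\<delta> * real l)\<rfloor>"
  let ?p = "random_words ?m \<delta> l"
  have p: "?p = replicate_pmf ?N (pmf_of_set (words ?m l))"
    by (simp add: random_words_def M_def)
  have "\<forall>i. \<exists>j. i < n \<longrightarrow> j < ?m \<and> ?g ! j = a i" "\<forall>i. \<exists>j. i < n \<longrightarrow> j < ?m \<and> ?g ! j = b i"
  proof -
    have "a i \<in> set ?g" "b i \<in> set ?g" if "i < n" for i
      using that k by (auto simp: walk_gens_def)
    then show "\<forall>i. \<exists>j. i < n \<longrightarrow> j < ?m \<and> ?g ! j = a i" "\<forall>i. \<exists>j. i < n \<longrightarrow> j < ?m \<and> ?g ! j = b i"
      unfolding in_set_conv_nth by blast+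
  qed
  then obtain ja jb where ja: "\<And>i. i < n \<Longrightarrow> ja i < ?m \<and> ?g ! ja i = a i"
    and jb: "\<And>i. i < n \<Longrightarrow> jb i < ?m \<and> ?g ! jb i = b i" by metis
  define hit_b where "hit_b i = words_ending_in ({..<k * n} \<times> UNIV) (jb i) l" for i
  define hit_a where "hit_a i = words_ending_in ({k * n..<2 * k * n} \<times> UNIV) (ja i) l" for i
  define avoid :: "(nat \<times> bool) list set \<Rightarrow> (nat \<times> bool) list list set"
    where "avoid X = {R. set R \<inter> X = {}}" for X
  have "2 * k * n \<le> ?m" by (simp add: length_walk_gens)
  then have sub: "{..<k * n} \<subseteq> {..<?m}" "{k * n..<2 * k * n} \<subseteq> {..<?m}" by auto
  have card: "card {..<k * n} = k * n" "card {k * n..<2 * k * n} = k * n" by (simp_all add: mult.assoc)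
  have avoid: "measure_pmf.prob ?p (avoid (words_ending_in (J \<times> UNIV) j l))
      = (1 - t ^ (l - 1) / M ^ l) ^ ?N"
    if J: "J \<subseteq> {..<?m}" "card J = k * n" and j: "j < ?m" for J j
  proof -
    have "real (card (J \<times> (UNIV :: bool set))) = t"
      using J(2) by (simp add: card_cartesian_product card_UNIV_bool t_def)
    moreover have "J \<times> UNIV \<subseteq> {..<?m} \<times> (UNIV :: bool set)" using J(1) by auto
    ultimately show ?thesis
      unfolding p avoid_def prob_replicate_pmf_avoid
      using prob_words_ending_in[of "J \<times> UNIV" ?m j l] j l by (simp add: M_def)
  qed
  have avoid_b: "measure_pmf.prob ?p (avoid (hit_b i)) = (1 - t ^ (l - 1) / M ^ l) ^ ?N"
    and avoid_a: "measure_pmf.prob ?p (avoid (hit_a i)) = (1 - t ^ (l - 1) / M ^ l) ^ ?N" if i: "i < n" for i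
    using avoid[OF sub(1) card(1)] avoid[OF sub(2) card(2)] ja[OF i] jb[OF i]
    unfolding hit_a_def hit_b_def by blast+
  have "?m > 0" by (simp add: length_walk_gens)
  then have "words ?m l \<noteq> {}"
    using card_words[of ?m l] by auto
  then have support: "set_pmf ?p \<subseteq> {R. set R \<subseteq> words ?m l}"
    by (auto simp: p set_replicate_pmf)
  have "measure_pmf.prob ?p {R. infinite (carrier (quotient_by_words G ?g R))}
      \<le> measure_pmf.prob ?p (\<Union>i<n. avoid (hit_b i) \<union> avoid (hit_a i))"
  proof (rule measure_pmf.finite_measure_mono_AE)
    show "AE R in measure_pmf ?p. R \<in> {R. infinite (carrier (quotient_by_words G ?g R))}
        \<longrightarrow> R \<in> (\<Union>i<n. avoid (hit_b i) \<union> avoid (hit_a i))"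
    proof (rule AE_pmfI, rule impI, rule ccontr)
      fix R assume R: "R \<in> set_pmf ?p" "R \<in> {R. infinite (carrier (quotient_by_words G ?g R))}"
        "R \<notin> (\<Union>i<n. avoid (hit_b i) \<union> avoid (hit_a i))"
      have "finite (carrier (quotient_by_words G ?g R))"
      proof (rule finite_quotient_by_words[OF _ ja jb])
        show "set R \<subseteq> words ?m l" using support R(1) by blast
        show "set R \<inter> words_ending_in ({..<k * n} \<times> UNIV) (jb i) l \<noteq> {}" if "i < n" for i
          using R(3) that unfolding avoid_def hit_b_def by blast
        show "set R \<inter> words_ending_in ({k * n..<2 * k * n} \<times> UNIV) (ja i) l \<noteq> {}" if "i < n" for i
          using R(3) that unfolding avoid_def hit_a_def by blast
      qed
      then show False using R(2) by simp
    qed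
  qed simp
  also have "\<dots> \<le> (\<Sum>i<n. measure_pmf.prob ?p (avoid (hit_b i) \<union> avoid (hit_a i)))"
    by (intro measure_pmf.finite_measure_subadditive_finite) auto
  also have "\<dots> \<le> (\<Sum>i<n. 2 * (1 - t ^ (l - 1) / M ^ l) ^ ?N)"
  proof (rule sum_mono)
    fix i assume "i \<in> {..<n}"
    then have "i < n" by simp
    have "measure_pmf.prob ?p (avoid (hit_b i) \<union> avoid (hit_a i))
        \<le> measure_pmf.prob ?p (avoid (hit_b i)) + measure_pmf.prob ?p (avoid (hit_a i))"
      by (rule measure_Un_le) auto
    then show "measure_pmf.prob ?p (avoid (hit_b i) \<union> avoid (hit_a i))
        \<le> 2 * (1 - t ^ (l - 1) / M ^ l) ^ ?N"
      using avoid_a[OF \<open>i < n\<close>] avoid_b[OF \<open>i < n\<close>] by linarith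
  qed
  finally show ?thesis by simp
qed

text \<open>
  The density \<open>\<delta>\<close> is chosen such that the number of relators of length \<open>l\<close> is \<open>(M / \<tau>)\<^sup>l\<close> up to rounding. As
  \<open>\<Lambda> < \<tau>\<close>, it is below \<open>1 - \<theta>\<close>; as \<open>\<tau> < t\<close>, words of each required kind occur with probability
  tending to \<open>1\<close>.
\<close>

theorem no_phase_transition:
  assumes n: "n \<ge> 4"
  shows "\<not> random_quotient_phase_transition G"
proof
  assume transition: "random_quotient_phase_transition G"
  \<comment> \<open>For \<open>n \<ge> 4\<close> one has \<open>n - 15/4 \<ge> n/16\<close>, so \<open>t - \<Lambda> = k (n - 15/4) - 4n - 2\<close> is at least
     \<open>n - 2\<close> when \<open>k = 80\<close>.\<close>
  define k :: nat where "k = 80"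
  define \<Lambda> where "\<Lambda> = real k * (real n + 15 / 4) + 4 * real n + 2"
  define t where "t = 2 * real k * real n"
  define M where "M = 2 * real (length (walk_gens k))"
  define \<tau> where "\<tau> = (\<Lambda> + t) / 2"
  have k: "k > 0" by (simp add: k_def)
  have bounds: "1 < \<Lambda>" "\<Lambda> < \<tau>" "\<tau> < t" "1 \<le> t" "t \<le> M"
    using n by (simp_all add: \<Lambda>_def t_def \<tau>_def M_def k_def length_walk_gens)
  have gens: "walk_gens k \<noteq> []" by (simp add: walk_gens_def)
  obtain \<theta> where \<theta>: "has_gross_cogrowth G (walk_gens k) \<theta>" "\<theta> \<le> log M \<Lambda>"
    using has_gross_cogrowth_exists[OF walk_gens_closed gens, of \<Lambda>]
      card_trivial_walk_words_le[of k] bounds(1) unfolding \<Lambda>_def M_def by auto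
  define \<delta> where "\<delta> = 1 - log M \<tau>"
  have "log M \<Lambda> < log M \<tau>" using bounds by simp
  then have "\<delta> < 1 - \<theta>" using \<theta>(2) by (simp add: \<delta>_def)
  moreover have "\<delta> \<in> {0..1}"
  proof -
    have "0 \<le> log M \<tau>" using bounds by (subst zero_le_log_cancel_iff) auto
    moreover have "log M \<tau> \<le> log M M" using bounds by (subst log_le_cancel_iff) auto
    ultimately show ?thesis using bounds by (simp add: \<delta>_def)
  qed
  ultimately have "random_quotient_asymptotically_surely G (walk_gens k) \<delta> non_elementary_hyperbolic"
    using transition generating_walk_gens[OF k] \<theta>(1)
    unfolding random_quotient_phase_transition_def by blast
  then have to_1: "(\<lambda>l. measure_pmf.prob (random_words (length (walk_gens k)) \<delta> l)
      {R. non_elementary_hyperbolic (quotient_by_words G (walk_gens k) R)}) \<longlonglongrightarrow> 1"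
    unfolding random_quotient_asymptotically_surely_def .
  have powr: "M powr (\<delta> * real l) = (M / \<tau>) ^ l" for l
  proof -
    have "M powr \<delta> = M / \<tau>"
      using bounds by (simp add: \<delta>_def powr_diff)
    then show ?thesis
      using bounds by (simp add: powr_powr[symmetric] powr_realpow)
  qed
  have "(\<lambda>l. 2 * real n * (1 - t ^ (l - 1) / M ^ l) ^ nat \<lfloor>(M / \<tau>) ^ l\<rfloor>) \<longlonglongrightarrow> 2 * real n * 0"
    by (intro tendsto_mult tendsto_const miss_probability_tendsto_0) (use bounds in auto)
  then have to_0: "(\<lambda>l. 2 * real n * (1 - t ^ (l - 1) / M ^ l) ^ nat \<lfloor>(M / \<tau>) ^ l\<rfloor>) \<longlonglongrightarrow> 0"
    by simp
  have "(\<lambda>l. measure_pmf.prob (random_words (length (walk_gens k)) \<delta> l)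
      {R. non_elementary_hyperbolic (quotient_by_words G (walk_gens k) R)}) \<longlonglongrightarrow> 0"
  proof (rule tendsto_sandwich[OF _ _ tendsto_const to_0])
    show "\<forall>\<^sub>F l in sequentially. measure_pmf.prob (random_words (length (walk_gens k)) \<delta> l)
        {R. non_elementary_hyperbolic (quotient_by_words G (walk_gens k) R)}
      \<le> 2 * real n * (1 - t ^ (l - 1) / M ^ l) ^ nat \<lfloor>(M / \<tau>) ^ l\<rfloor>"
    proof (rule eventually_sequentiallyI[of 1])
      fix l :: nat assume l: "1 \<le> l"
      have "measure_pmf.prob (random_words (length (walk_gens k)) \<delta> l)
          {R. non_elementary_hyperbolic (quotient_by_words G (walk_gens k) R)}
        \<le> measure_pmf.prob (random_words (length (walk_gens k)) \<delta> l)
          {R. infinite (carrier (quotient_by_words G (walk_gens k) R))}"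
        by (rule measure_pmf.finite_measure_mono) (auto simp: non_elementary_hyperbolic_def)
      also have "\<dots> \<le> 2 * real n * (1 - t ^ (l - 1) / M ^ l) ^ nat \<lfloor>(M / \<tau>) ^ l\<rfloor>"
        using prob_infinite_quotient_le[OF k l, of \<delta>] by (simp only: t_def M_def powr[unfolded M_def])
      finally show "measure_pmf.prob (random_words (length (walk_gens k)) \<delta> l)
          {R. non_elementary_hyperbolic (quotient_by_words G (walk_gens k) R)}
        \<le> 2 * real n * (1 - t ^ (l - 1) / M ^ l) ^ nat \<lfloor>(M / \<tau>) ^ l\<rfloor>" .
    qed
  qed simp
  then show False using to_1 LIMSEQ_unique zero_neq_one by blast
qed

end

section \<open>The group\<close>

definition flip :: "'p \<times> bool \<Rightarrow> 'p \<times> bool" where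
  "flip p = (fst p, \<not> snd p)"

lemma flip_flip [simp]: "flip (flip p) = p"
  by (simp add: flip_def)

lemma flip_normal_forms [simp]: "flip p \<in> normal_forms n \<longleftrightarrow> p \<in> normal_forms n"
  by (cases p) (simp add: flip_def normal_forms_def)


text \<open>
  The actions of the free generators of the two factors on normal forms. On a normal form \<open>w e\<^sup>s\<close> the
  letter \<open>a\<^sub>i\<close> passes \<open>e\<^sup>s\<close> unchanged, whereas \<open>b\<^sub>i\<close> becomes \<open>e b\<^sub>i e\<close> if \<open>s\<close> holds.
\<close>

definition push_a :: "nat \<times> bool \<Rightarrow> (gen \<times> bool) list \<times> bool \<Rightarrow> (gen \<times> bool) list \<times> bool" where
  "push_a x p = (push (fst p) (A (fst x), snd x), snd p)"

definition push_b :: "nat \<times> bool \<Rightarrow> (gen \<times> bool) list \<times> bool \<Rightarrow> (gen \<times> bool) list \<times> bool" where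
  "push_b x p = (push (fst p) (twist (snd p) (B (fst x), snd x)), snd p)"

lemma push_a_closed: "x \<in> {..<n} \<times> UNIV \<Longrightarrow> p \<in> normal_forms n \<Longrightarrow> push_a x p \<in> normal_forms n"
  and push_b_closed: "x \<in> {..<n} \<times> UNIV \<Longrightarrow> p \<in> normal_forms n \<Longrightarrow> push_b x p \<in> normal_forms n"
  unfolding push_a_def push_b_def by (auto intro!: push_normal_form[of _ "snd p"])

lemma push_a_relators:
  assumes "(u, v) \<in> inverse_relators {..<n}" "p \<in> normal_forms n"
  shows "fold push_a u p = fold push_a v p"
  using assms push_push_inv[of "fst p" "(A _, _)"]
  by (cases p) (auto simp: inverse_relators_def push_a_def normal_forms_def)

lemma push_b_relators:
  assumes "(u, v) \<in> inverse_relators {..<n}" "p \<in> normal_forms n"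
  shows "fold push_b u p = fold push_b v p"
proof -
  obtain w s where p: "p = (w, s)" "reduced w" using assms(2) by (cases p) (auto simp: normal_forms_def)
  obtain i t where u: "u = [(i, t), (i, \<not> t)]" "v = []" using assms(1) by (auto simp: inverse_relators_def)
  have inverse: "twist s (B i, \<not> t) = inv_letter (twist s (B i, t))"
    by (simp flip: twist_simps(3))
  then show ?thesis
    using push_push_inv[OF p(2), of "twist s (B i, t)"] by (simp add: p u push_b_def inverse)
qed

lemma flip_push_a: "push_a x (flip p) = flip (push_a x p)"
  by (simp add: flip_def push_a_def)

locale free_times_two_star_free =
  fixes n :: nat
begin

abbreviation "F \<equiv> free_group {..<n}"
abbreviation "Q \<equiv> F \<times>\<times> integer_mod_group 2"
abbreviation "fcls \<equiv> free.cls {..<n}"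

sublocale free_product_of_groups Q F
  unfolding free_product_of_groups_def
  by (intro conjI DirProd_group group_free_group) simp

lemma carrier_Z2: "carrier (integer_mod_group 2) = {0, 1}"
  by (auto simp: carrier_integer_mod_group)

definition act_a where "act_a = free.class_action push_a"
definition act_b where "act_b = free.class_action push_b"

lemmas act_a = free.class_action[OF push_a_closed push_a_relators, folded free_group_eq act_a_def]
lemmas act_b = free.class_action[OF push_b_closed push_b_relators, folded free_group_eq act_b_def]

text \<open>
  The actions of the two direct factors \<open>F\<close> and \<open>\<int>/2\<int>\<close> commute, so that their product acts.
\<close>

lemma act_a_flip:
  assumes "X \<in> carrier F" "p \<in> normal_forms n"
  shows "act_a X (flip p) = flip (act_a X p)"
proof -
  have "X \<in> carrier (presented_monoid ({..<n} \<times> UNIV) (inverse_relators {..<n}))"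
    using assms(1) by (simp add: free_group_eq)
  then obtain u where u: "X = fcls u" by (rule free.carrierE)
  have *: "act_a X q = fold push_a u q" if "q \<in> normal_forms n" for q
    unfolding u act_a_def
    by (rule free.class_action_cls[OF push_a_closed push_a_relators that])
  have "fold push_a v (flip q) = flip (fold push_a v q)" for v q
    by (induction v arbitrary: q) (simp_all add: flip_push_a)
  then show ?thesis using assms(2) by (simp add: *)
qed

fun letter_act :: "(nat \<times> bool) list set \<times> int + (nat \<times> bool) list set
    \<Rightarrow> (gen \<times> bool) list \<times> bool \<Rightarrow> (gen \<times> bool) list \<times> bool" where
  "letter_act (Inl (X, z)) p = (if z = 0 then act_a X p else flip (act_a X p))"
| "letter_act (Inr Y) p = act_b Y p"

lemma letter_act_closed:
  assumes "x \<in> factor_letters" "p \<in> normal_forms n"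
  shows "letter_act x p \<in> normal_forms n"
  using assms by (cases "(x, p)" rule: letter_act.cases) (auto simp: act_a(3) act_b(3))

text \<open>
  Multiplication in either factor is respected because \<open>act_a\<close>, \<open>act_b\<close> and \<open>flip\<close> are actions; that
  \<open>flip\<close> has order \<open>2\<close> matches addition modulo \<open>2\<close>.
\<close>

lemma letter_act_relators:
  assumes "(u, v) \<in> factor_relators" "p \<in> normal_forms n"
  shows "fold letter_act u p = fold letter_act v p"
  using assms
  by (auto simp: factor_relators_def act_a act_b carrier_Z2 act_a_flip)

definition act where "act = class_action letter_act"

lemmas act = class_action[OF letter_act_closed letter_act_relators, folded act_def]

definition a where "a i = inl (fcls [(i, True)], 0)"
definition b where "b i = inr (fcls [(i, True)])"
definition e where "e = inl (\<one>\<^bsub>F\<^esub>, 1)"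

lemma fcls_closed: "u \<in> lists ({..<n} \<times> UNIV) \<Longrightarrow> fcls u \<in> carrier F"
  unfolding free_group_eq by (rule free.cls_in_carrier)

lemma fcls_mult:
  "u \<in> lists ({..<n} \<times> UNIV) \<Longrightarrow> v \<in> lists ({..<n} \<times> UNIV) \<Longrightarrow> fcls u \<otimes>\<^bsub>F\<^esub> fcls v = fcls (u @ v)"
  unfolding free_group_eq by (rule free.mult_cls)

lemma generator_closed: "i < n \<Longrightarrow> fcls [(i, s)] \<in> carrier F"
  by (rule fcls_closed) auto

text \<open>
  Used for both embeddings of the free group, into the first factor and into the second.
\<close>

lemma factor_subset:
  assumes \<iota>: "\<iota> \<one>\<^bsub>F\<^esub> = \<one>\<^bsub>M\<^esub>" "\<And>X. X \<in> carrier F \<Longrightarrow> \<iota> X \<in> carrier M"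
      "\<And>X Y. X \<in> carrier F \<Longrightarrow> Y \<in> carrier F \<Longrightarrow> \<iota> (X \<otimes>\<^bsub>F\<^esub> Y) = \<iota> X \<otimes>\<^bsub>M\<^esub> \<iota> Y"
    and K: "subgroup K M" "\<And>i. i < n \<Longrightarrow> \<iota> (fcls [(i, True)]) \<in> K"
  shows "\<iota> ` carrier F \<subseteq> K"
proof
  interpret M: group M by (rule group_free_product)
  fix g assume "g \<in> \<iota> ` carrier F"
  then obtain u where u: "u \<in> lists ({..<n} \<times> UNIV)" "g = \<iota> (fcls u)"
    unfolding free_group_eq by (auto elim: free.carrierE)
  have one: "fcls [] = \<one>\<^bsub>F\<^esub>" by (simp add: free_group_eq free.one_eq)
  have generator: "\<iota> (fcls [(i, s)]) \<in> K" if i: "i < n" for i s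
  proof (cases s)
    case False
    have "fcls [(i, False)] \<otimes>\<^bsub>F\<^esub> fcls [(i, True)] = fcls [(i, False), (i, True)]"
      using i by (subst fcls_mult) auto
    also have "\<dots> = \<one>\<^bsub>F\<^esub>"
      unfolding one[symmetric] using i by (intro free.cls_relator) (auto simp: inverse_relators_def)
    finally have "\<iota> (fcls [(i, False)]) \<otimes>\<^bsub>M\<^esub> \<iota> (fcls [(i, True)]) = \<one>\<^bsub>M\<^esub>"
      using i \<iota>(1) by (simp add: \<iota>(3)[symmetric] generator_closed)
    then have "\<iota> (fcls [(i, False)]) = inv\<^bsub>M\<^esub> (\<iota> (fcls [(i, True)]))"
      using i \<iota>(2) by (intro M.inv_equality[symmetric]) (auto simp: generator_closed)
    then show ?thesis
      using subgroup.m_inv_closed[OF K(1) K(2)[OF i]] False by simp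
  qed (use K(2) i in simp)
  have "\<iota> (fcls u) \<in> K"
    using u(1)
  proof (induction u)
    case Nil
    then show ?case using subgroup.one_closed[OF K(1)] \<iota>(1) by (simp add: one)
  next
    case (Cons x u)
    then have "fcls (x # u) = fcls [x] \<otimes>\<^bsub>F\<^esub> fcls u"
      by (subst fcls_mult) auto
    then have "\<iota> (fcls (x # u)) = \<iota> (fcls [x]) \<otimes>\<^bsub>M\<^esub> \<iota> (fcls u)"
      using Cons \<iota>(3) generator_closed[of "fst x" "snd x"] fcls_closed[of u] by auto
    then show ?case
      using Cons subgroup.m_closed[OF K(1)] generator[of "fst x" "snd x"] by auto
  qed
  then show "g \<in> K" using u(2) by simp
qed

sublocale swap_extension M n a b e act
proof -
  interpret M: group M by (rule group_free_product)
  have e: "e \<in> carrier M" by (simp add: e_def carrier_Z2)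
  show "swap_extension M n a b e act"
  proof
    show "a i \<in> carrier M" "b i \<in> carrier M" if "i < n" for i
      using generator_closed[OF that] by (simp_all add: a_def b_def carrier_Z2)
    show "e \<in> carrier M" by (fact e)
    show "e \<otimes>\<^bsub>M\<^esub> e = \<one>\<^bsub>M\<^esub>"
      using inl_one by (simp add: e_def inl_mult[symmetric] carrier_Z2)
    show "e \<otimes>\<^bsub>M\<^esub> a i = a i \<otimes>\<^bsub>M\<^esub> e" if "i < n" for i
      using generator_closed[OF that] by (simp add: e_def a_def inl_mult[symmetric] carrier_Z2)
    show "act g p \<in> normal_forms n" if "g \<in> carrier M" "p \<in> normal_forms n" for g p
      using act(3) that by blast
    show "act (g \<otimes>\<^bsub>M\<^esub> h) p = act h (act g p)"
      if "g \<in> carrier M" "h \<in> carrier M" "p \<in> normal_forms n" for g h p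
      using act(4) that by blast
    show "act \<one>\<^bsub>M\<^esub> p = p" if "p \<in> normal_forms n" for p
      using act(2) that by blast
    show "act (a i) (w, s) = (push w (A i, True), s)" if "i < n" "(w, s) \<in> normal_forms n" for i w s
      using that generator_closed[of i True] by (simp add: a_def inl_def act(1) act_a(1) carrier_Z2 push_a_def)
    show "act (b i) (w, s) = (push w (twist s (B i, True)), s)" if "i < n" "(w, s) \<in> normal_forms n" for i w s
      using that generator_closed[of i True] by (simp add: b_def inr_def act(1) act_b(1) push_b_def)
    show "act e (w, s) = (w, \<not> s)" if "(w, s) \<in> normal_forms n" for w s
      using that by (simp add: e_def inl_def act(1) act_a(2) carrier_Z2 flip_def)
    let ?S = "a ` {..<n} \<union> b ` {..<n} \<union> {e}"
    have "?S \<subseteq> carrier M"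
      using e generator_closed by (auto simp: a_def b_def carrier_Z2)
    then have K: "subgroup (generate M ?S) M" by (rule M.generate_is_subgroup)
    show "generate M ?S = carrier M"
    proof (rule factors_generate[OF K])
      have a: "(\<lambda>X. inl (X, 0)) ` carrier F \<subseteq> generate M ?S"
      proof (rule factor_subset[OF _ _ _ K])
        show "inl (fcls [(i, True)], 0) \<in> generate M ?S" if "i < n" for i
          using that by (intro generate.incl) (auto simp: a_def)
      qed (use inl_one in \<open>simp_all add: carrier_Z2 inl_mult[symmetric]\<close>)
      show "inr ` carrier F \<subseteq> generate M ?S"
      proof (rule factor_subset[OF _ _ _ K])
        show "inr (fcls [(i, True)]) \<in> generate M ?S" if "i < n" for i
          using that by (intro generate.incl) (auto simp: b_def)
      qed (simp_all add: inr_one inr_mult)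
      show "inl ` carrier Q \<subseteq> generate M ?S"
      proof
        fix g assume "g \<in> inl ` carrier Q"
        then obtain X z where X: "X \<in> carrier F" "z \<in> {0, 1}" "g = inl (X, z)"
          by (auto simp: carrier_Z2)
        then consider "g = inl (X, 0)" | "g = inl (X, 1)" by blast
        then show "g \<in> generate M ?S"
        proof cases
          case 1
          then show ?thesis using a X(1) by blast
        next
          case 2
          then have "g = inl (X, 0) \<otimes>\<^bsub>M\<^esub> e"
            using X(1) by (simp add: e_def inl_mult[symmetric] carrier_Z2)
          moreover have "e \<in> generate M ?S" by (intro generate.incl) simp
          ultimately show ?thesis using a X(1) by (auto intro: generate.eng)
        qed
      qed
    qed
  qed
qed

end

theorem proposition73:
  "let G = free_product (free_group {..<4::nat} \<times>\<times> integer_mod_group 2) (free_group {..<4::nat})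
   in hyperbolic_group G \<and> \<not> random_quotient_phase_transition G"
proof -
  interpret free_times_two_star_free 4 .
  show ?thesis
    unfolding Let_def free_product_eq using hyperbolic no_phase_transition by simp
qed

end
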